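(* Let $\mathcal{H}$ be a separable complex Hilbert space, let $A:\mathcal{H}\to\mathcal{H}$ be a bounded linear operator with $\|A\|<1$, let $N\ge 1$ be an integer, let $\mathcal{W}$ be a closed subspace of $\mathcal{H}$, and let $\{g_j\}_{j\in J}\subset\mathcal{H}$ be a countable Bessel sequence. For $0\le s\le N-1$ let $T_s:=(e^{2\pi i s/N}I-A)^{-1}$. Then the following are equivalent: (1) There exists a bounded linear operator $R:\mathcal{M}_N\to\mathcal{W}^N$ such that, for every $N$-periodic sequence $w$ with values in $\mathcal{W}$ and every sequence $x:\{0,1,2,\dots\}\to\mathcal{H}$ (with arbitrary initial state $x(0)\in\mathcal{H}$) satisfying $x(n+1)=Ax(n)+w(n)$ for all $n\ge 0$, one has $R\big(\{\langle x(n),g_j\rangle\}_{n\ge 0,\,j\in J}\big)=w$, where $w$ is identified with $(w(0),\dots,w(N-1))\in\mathcal{W}^N$. (2) For every $s=0,\dots,N-1$, the family $\{P_{\mathcal{W}}(T_s^*g_j)\}_{j\in J}$ is a frame of $\mathcal{W}$. (3) For every $s=0,\dots,N-1$, the family $\{P_{\mathcal{W}_s}(g_j)\}_{j\in J}$ is a frame of $\mathcal{W}_s$, where $\mathcal{W}_s=T_s(\mathcal{W})$.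
   Context: For a closed subspace $\mathcal{V}\subset\mathcal{H}$, $P_{\mathcal{V}}$ denotes the orthogonal projection onto $\mathcal{V}$. A family $\{g_j\}_{j\in J}$ is a Bessel sequence in $\mathcal{H}$ if there is $C>0$ with $\sum_j|\langle h,g_j\rangle|^2\le C\|h\|^2$ for all $h\in\mathcal{H}$; a family $\{f_j\}\subset\mathcal{V}$ is a frame of $\mathcal{V}$ if there are $0<m\le M<\infty$ with $m\|v\|^2\le\sum_j|\langle v,f_j\rangle|^2\le M\|v\|^2$ for all $v\in\mathcal{V}$. Since $\|A\|<1$, each $e^{2\pi i s/N}I-A$ is boundedly invertible. $\mathcal{W}^N$ carries the norm $\|h\|^2=\sum_{i=1}^N\|h_i\|^2$. The space $\mathcal{B}(\ell^2,\ell^\infty)$ is the set of doubly infinite complex matrices $D=[d_{i,j}]$ whose rows $r_i$ all belong to $\ell^2$ and satisfy $\sup_i\|r_i\|_{\ell^2}<\infty$, with norm $\|D\|_{\ell^2\to\ell^\infty}=\sup_i\|r_i\|_{\ell^2}$. The space $\mathcal{M}_N$ is the subspace of those $D\in\mathcal{B}(\ell^2,\ell^\infty)$ such that for each residue $s$ modulo $N$ there is $t_s\in\ell^2$ with $\lim_{k\to\infty}\|r_{Nk+s}-t_s\|_{\ell^2}=0$, with the induced norm. Here the rows are indexed by time $n\ge 0$ and the columns by $j\in J$ (so $\ell^2=\ell^2(J)$). When $\{g_j\}$ is Bessel, the sample matrix $\{\langle x(n),g_j\rangle\}_{n\ge0,j\in J}$ of any solution $x$ belongs to $\mathcal{M}_N$.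 *)

theory Defs
  imports "HOL-Analysis.Analysis"
begin

section \<open>Complex Hilbert spaces\<close>

text \<open>
  The complex inner product is linear in its first argument and conjugate-linear in the second.
  Norm, metric and topology are those of the underlying real inner product space, whose inner
  product is the real part of the complex one. Positive definiteness is inherited from
  \<^class>\<open>real_inner\<close>; see \<open>cinner_self\<close> below.
\<close>

class complex_inner = real_inner +
  fixes scaleC :: "complex \<Rightarrow> 'a \<Rightarrow> 'a" (infixr "*\<^sub>C" 75)
    and cinner :: "'a \<Rightarrow> 'a \<Rightarrow> complex"
  assumes scaleC_add_right: "a *\<^sub>C (x + y) = a *\<^sub>C x + a *\<^sub>C y"
    and scaleC_add_left: "(a + b) *\<^sub>C x = a *\<^sub>C x + b *\<^sub>C x"
    and scaleC_scaleC: "a *\<^sub>C b *\<^sub>C x = (a * b) *\<^sub>C x"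
    and scaleR_scaleC: "r *\<^sub>R x = complex_of_real r *\<^sub>C x"
    and cinner_commute: "cinner x y = cnj (cinner y x)"
    and cinner_add_left: "cinner (x + y) z = cinner x z + cinner y z"
    and cinner_scaleC_left: "cinner (a *\<^sub>C x) y = a * cinner x y"
    and inner_eq_Re_cinner: "inner x y = Re (cinner x y)"

class complex_hilbert = complex_inner + complete_space

lemma cinner_self:
  fixes x :: "'a::complex_inner"
  shows "cinner x x = complex_of_real ((norm x)\<^sup>2)"
proof (rule complex_eqI)
  show "Re (cinner x x) = Re (complex_of_real ((norm x)\<^sup>2))"
    by (simp add: power2_norm_eq_inner inner_eq_Re_cinner)
  have "Im (cinner x x) = - Im (cinner x x)"
    using arg_cong[OF cinner_commute[of x x], of Im] by simp
  then show "Im (cinner x x) = Im (complex_of_real ((norm x)\<^sup>2))"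
    by simp
qed

instantiation complex :: complex_hilbert
begin

definition scaleC_complex :: "complex \<Rightarrow> complex \<Rightarrow> complex"
  where "scaleC_complex a x = a * x"

definition cinner_complex :: "complex \<Rightarrow> complex \<Rightarrow> complex"
  where "cinner_complex x y = x * cnj y"

instance
  by standard
    (auto simp: scaleC_complex_def cinner_complex_def inner_complex_def algebra_simps
      scaleR_conv_of_real)

end

global_interpretation complex_vector:
  vector_space "scaleC :: complex \<Rightarrow> 'a \<Rightarrow> 'a::complex_inner"
  defines csubspace = complex_vector.subspace
proof
  fix x :: 'a
  show "1 *\<^sub>C x = x"
    using scaleR_scaleC[of 1 x] by simp
qed (simp_all add: scaleC_add_right scaleC_add_left scaleC_scaleC)

definition bounded_clinear :: "('a::complex_inner \<Rightarrow> 'b::complex_inner) \<Rightarrow> bool"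
  where "bounded_clinear f \<longleftrightarrow> bounded_linear f \<and> (\<forall>c x. f (c *\<^sub>C x) = c *\<^sub>C f x)"

definition cadjoint :: "('a::complex_inner \<Rightarrow> 'b::complex_inner) \<Rightarrow> 'b \<Rightarrow> 'a"
  where "cadjoint T = (THE S. \<forall>x y. cinner (T x) y = cinner x (S y))"

definition orth_proj :: "'a::complex_inner set \<Rightarrow> 'a \<Rightarrow> 'a"
  where "orth_proj V x = (THE p. p \<in> V \<and> (\<forall>v\<in>V. cinner (x - p) v = 0))"

section \<open>Bessel sequences and frames\<close>

text \<open>
  \<^const>\<open>infsum\<close> is \<open>0\<close> on divergent families, so convergence is demanded separately.
\<close>

definition bessel_sequence :: "'j set \<Rightarrow> ('j \<Rightarrow> 'a::complex_inner) \<Rightarrow> bool"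
  where "bessel_sequence J g \<longleftrightarrow>
    (\<exists>C>0. \<forall>h. (\<lambda>j. (cmod (cinner h (g j)))\<^sup>2) summable_on J \<and>
      (\<Sum>\<^sub>\<infinity>j\<in>J. (cmod (cinner h (g j)))\<^sup>2) \<le> C * (norm h)\<^sup>2)"

definition frame_of :: "'j set \<Rightarrow> ('j \<Rightarrow> 'a::complex_inner) \<Rightarrow> 'a set \<Rightarrow> bool"
  where "frame_of J f V \<longleftrightarrow>
    (\<forall>j\<in>J. f j \<in> V) \<and>
    (\<exists>m M. 0 < m \<and> m \<le> M \<and>
      (\<forall>v\<in>V. (\<lambda>j. (cmod (cinner v (f j)))\<^sup>2) summable_on J \<and>
        m * (norm v)\<^sup>2 \<le> (\<Sum>\<^sub>\<infinity>j\<in>J. (cmod (cinner v (f j)))\<^sup>2) \<and>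
        (\<Sum>\<^sub>\<infinity>j\<in>J. (cmod (cinner v (f j)))\<^sup>2) \<le> M * (norm v)\<^sup>2))"

section \<open>Spaces of matrices\<close>

text \<open>
  Families indexed by \<open>J\<close> are functions on the ambient type that vanish outside \<open>J\<close>, so that
  equality of functions is equality of families and the vector space operations are pointwise.
  The rows of a matrix \<open>D\<close> are \<open>D n\<close>, \<open>n \<ge> 0\<close>.
\<close>

definition ell2 :: "'j set \<Rightarrow> ('j \<Rightarrow> complex) set"
  where "ell2 J = {a. (\<forall>j. j \<notin> J \<longrightarrow> a j = 0) \<and> (\<lambda>j. (cmod (a j))\<^sup>2) summable_on J}"

definition ell2_norm :: "'j set \<Rightarrow> ('j \<Rightarrow> complex) \<Rightarrow> real"
  where "ell2_norm J a = sqrt (\<Sum>\<^sub>\<infinity>j\<in>J. (cmod (a j))\<^sup>2)"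

definition B_ell2_ellinf :: "'j set \<Rightarrow> (nat \<Rightarrow> 'j \<Rightarrow> complex) set"
  where "B_ell2_ellinf J =
    {D. (\<forall>n. D n \<in> ell2 J) \<and> bdd_above (range (\<lambda>n. ell2_norm J (D n)))}"

definition B_norm :: "'j set \<Rightarrow> (nat \<Rightarrow> 'j \<Rightarrow> complex) \<Rightarrow> real"
  where "B_norm J D = (SUP n. ell2_norm J (D n))"

definition M_space :: "'j set \<Rightarrow> nat \<Rightarrow> (nat \<Rightarrow> 'j \<Rightarrow> complex) set"
  where "M_space J N =
    {D \<in> B_ell2_ellinf J.
      \<forall>s<N. \<exists>t\<in>ell2 J. (\<lambda>k. ell2_norm J (\<lambda>j. D (N * k + s) j - t j)) \<longlonglongrightarrow> 0}"

definition sample_matrix ::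
    "'j set \<Rightarrow> ('j \<Rightarrow> 'a::complex_inner) \<Rightarrow> (nat \<Rightarrow> 'a) \<Rightarrow> nat \<Rightarrow> 'j \<Rightarrow> complex"
  where "sample_matrix J g x = (\<lambda>n j. if j \<in> J then cinner (x n) (g j) else 0)"

section \<open>The space \<open>W\<^sup>N\<close> and bounded operators into it\<close>

text \<open>
  An \<open>N\<close>-tuple \<open>(h 0, \<dots>, h (N - 1))\<close> is a function on \<^typ>\<open>nat\<close> that vanishes from \<open>N\<close> on.
\<close>

definition power_space :: "'a::complex_inner set \<Rightarrow> nat \<Rightarrow> (nat \<Rightarrow> 'a) set"
  where "power_space W N = {h. (\<forall>i<N. h i \<in> W) \<and> (\<forall>i\<ge>N. h i = 0)}"

definition power_norm :: "nat \<Rightarrow> (nat \<Rightarrow> 'a::complex_inner) \<Rightarrow> real"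
  where "power_norm N h = sqrt (\<Sum>i<N. (norm (h i))\<^sup>2)"

definition first_tuple :: "nat \<Rightarrow> (nat \<Rightarrow> 'a::complex_inner) \<Rightarrow> nat \<Rightarrow> 'a"
  where "first_tuple N w = (\<lambda>i. if i < N then w i else 0)"

definition bounded_operator_M ::
    "'j set \<Rightarrow> nat \<Rightarrow> 'a::complex_inner set \<Rightarrow> ((nat \<Rightarrow> 'j \<Rightarrow> complex) \<Rightarrow> nat \<Rightarrow> 'a) \<Rightarrow> bool"
  where "bounded_operator_M J N W R \<longleftrightarrow>
    (\<forall>D\<in>M_space J N. R D \<in> power_space W N) \<and>
    (\<forall>D\<in>M_space J N. \<forall>E\<in>M_space J N.
      R (\<lambda>n j. D n j + E n j) = (\<lambda>i. R D i + R E i)) \<and>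
    (\<forall>c. \<forall>D\<in>M_space J N. R (\<lambda>n j. c * D n j) = (\<lambda>i. c *\<^sub>C R D i)) \<and>
    (\<exists>K. \<forall>D\<in>M_space J N. power_norm N (R D) \<le> K * B_norm J D)"

section \<open>Resolvents at the \<open>N\<close>-th roots of unity\<close>

text \<open>
  The map being inverted is bijective whenever \<open>A\<close> is bounded and linear with \<open>onorm A < 1\<close>
  on a complete space, so \<^const>\<open>inv\<close> is then the genuine inverse.
\<close>

definition resolvent_root :: "('a::complex_inner \<Rightarrow> 'a) \<Rightarrow> nat \<Rightarrow> nat \<Rightarrow> 'a \<Rightarrow> 'a"
  where "resolvent_root A N s =
    inv (\<lambda>x. exp (2 * of_real pi * \<i> * of_nat s / of_nat N) *\<^sub>C x - A x)"

end

(*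
  Conditions (2) and (3) both say that the map v -> (<T_s v, g_j>)_j is bounded below on W for each s.
  Given (1), this bound comes from the inputs w(n) = z^n v with z = e^(2 pi i s/N), whose response
  x(n) = z^n T_s v has a sample matrix with all rows of the same norm. Conversely, every response is
  asymptotic to the N-periodic steady state sum_s z_s^n T_s c_s, where c is the discrete Fourier
  transform of w; the limits of the sample rows along residue classes determine the sequences
  (<T_s c_s, g_j>)_j by a Fourier transform, and bounded left inverses of the maps above recover c.
*)
theory Submission
  imports Defs
begin

section \<open>Complex inner products\<close>

text \<open>Testing against vectors of a subspace removes the projection onto it, and the Bessel
  property supplies every upper frame bound. The two frame conditions therefore differ only by norm
  factors, which boundedness of \<open>T_s\<close> and its inverse controls.

  The obstacle is the operator \<open>R\<close>: it must be defined, linear and bounded on all of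
  \<open>M_space J N\<close>, whose rows are arbitrary elements of \<open>ell2 J\<close> and need
  not be samples of anything. A left inverse given on the range of the analysis operator is too
  small; least squares extends it to \<open>ell2 J\<close>. Moreover the left inverse for index
  \<open>s\<close> is correct only on the component of frequency \<open>s\<close>, while each limit
  row mixes all frequencies. Since linear maps commute with the Fourier transform, it may be applied
  to the mixture and the other frequencies discarded afterwards.

  Projections, adjoints and least squares solutions all come from one minimisation principle over
  real scalars; complex linearity is recovered by testing with complex multiples of vectors.\<close>

lemma cinner_add_right: "cinner (x::'a::complex_inner) (y + z) = cinner x y + cinner x z"
  by (metis cinner_add_left cinner_commute complex_cnj_add)

lemma cinner_scaleC_right: "cinner (x::'a::complex_inner) (c *\<^sub>C y) = cnj c * cinner x y"
  by (metis cinner_commute cinner_scaleC_left complex_cnj_mult)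

text \<open>The norm belongs to the real structure, so complex homogeneity is not an axiom; it is
  read off from \<open>cinner_self\<close>.\<close>

lemma norm_scaleC: "norm (c *\<^sub>C (x::'a::complex_inner)) = cmod c * norm x"
proof -
  have "complex_of_real ((norm (c *\<^sub>C x))\<^sup>2) = c * cnj c * cinner x x"
    by (simp only: cinner_self[symmetric] cinner_scaleC_left cinner_scaleC_right mult_ac)
  also have "\<dots> = complex_of_real ((cmod c * norm x)\<^sup>2)"
    by (simp add: cinner_self complex_norm_square power_mult_distrib mult_ac del: of_real_power)
  finally show ?thesis
    by (metis norm_ge_zero of_real_eq_iff power2_eq_iff_nonneg zero_le_mult_iff)
qed

lemma bounded_linear_scaleC: "bounded_linear ((*\<^sub>C) c :: 'a::complex_inner \<Rightarrow> 'a)"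
proof (rule bounded_linear_intro[where K = "cmod c"])
  show "c *\<^sub>C (r *\<^sub>R x) = r *\<^sub>R c *\<^sub>C x" for r and x :: 'a
    by (simp add: scaleR_scaleC scaleC_scaleC mult.commute)
qed (simp_all add: scaleC_add_right norm_scaleC mult.commute)

lemma csubspace_imp_subspace: "csubspace V \<Longrightarrow> subspace V"
  unfolding complex_vector.subspace_def subspace_def by (simp add: scaleR_scaleC)

text \<open>The real inner product at \<open>\<i> *\<^sub>C v\<close> is minus the imaginary part of
  the complex one at \<open>v\<close>. This upgrades representatives found over real scalars to
  complex ones.\<close>

lemma cinner_eq_of_inner_eq:
  fixes V :: "'a::complex_inner set" and f :: "'a \<Rightarrow> 'b::complex_inner"
  assumes "csubspace V" and "\<And>c x. f (c *\<^sub>C x) = c *\<^sub>C f x"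
    and eq: "\<And>v. v \<in> V \<Longrightarrow> inner (f v) a = inner v b" and "v \<in> V"
  shows "cinner (f v) a = cinner v b"
proof (rule complex_eqI)
  show "Re (cinner (f v) a) = Re (cinner v b)"
    using eq[OF \<open>v \<in> V\<close>] by (simp add: inner_eq_Re_cinner)
  have "\<i> *\<^sub>C v \<in> V"
    using assms(1,4) by (simp add: complex_vector.subspace_def)
  from eq[OF this] show "Im (cinner (f v) a) = Im (cinner v b)"
    by (simp add: inner_eq_Re_cinner assms(2) cinner_scaleC_left)
qed

section \<open>Coercive forms, projections and adjoints\<close>

text \<open>Symmetric Lax-Milgram by the direct method: the quadratic functional \<open>F\<close> is
  bounded below on \<open>V\<close>, the parallelogram identity makes minimising sequences Cauchy,
  and the first variation vanishes at the limit. With \<open>inner\<close> as the form this is Riesz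
  representation; with the form of an analysis operator it solves least squares problems.\<close>

lemma coercive_form_represents:
  fixes b :: "'a::{real_inner,complete_space} \<Rightarrow> 'a \<Rightarrow> real"
  assumes b: "bounded_bilinear b" and sym: "\<And>u v. b u v = b v u"
    and phi: "bounded_linear \<phi>"
    and V: "subspace V" "closed V"
    and m: "0 < m" "\<And>v. v \<in> V \<Longrightarrow> m * (norm v)\<^sup>2 \<le> b v v"
  shows "\<exists>u\<in>V. \<forall>v\<in>V. b u v = \<phi> v"
proof -
  interpret b: bounded_bilinear b by fact
  interpret phi: bounded_linear \<phi> by fact
  define F where "F v = b v v - 2 * \<phi> v" for v
  obtain K where K: "\<And>v. norm (\<phi> v) \<le> norm v * K" "0 < K"
    using phi.pos_bounded by blast
  have bdd: "- (K\<^sup>2 / m) \<le> F v" if "v \<in> V" for v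
  proof -
    \<comment> \<open>Completing the square: \<open>F v\<close> is at least
      \<open>m * (norm v)\<^sup>2 - 2 * K * norm v\<close>, whose smallest value is
      \<open>- (K\<^sup>2 / m)\<close>.\<close>
    have "0 \<le> (m * norm v - K)\<^sup>2 / m" using m(1) by simp
    also have "\<dots> = m * (norm v)\<^sup>2 - 2 * (norm v * K) + K\<^sup>2 / m"
      using m(1) by (simp add: field_simps power2_eq_square)
    also have "\<dots> \<le> F v + K\<^sup>2 / m"
      using m(2)[OF that] K(1)[of v] by (simp add: F_def)
    finally show ?thesis by simp
  qed
  define d where "d = Inf (F ` V)"
  have bb: "bdd_below (F ` V)" using bdd by (auto intro!: bdd_belowI)
  have ne: "F ` V \<noteq> {}" using subspace_0[OF V(1)] by blast
  have d_le: "d \<le> F v" if "v \<in> V" for v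
    unfolding d_def using that bb by (auto intro: cInf_lower)
  have "\<exists>u\<in>V. F u < d + 1 / Suc n" for n
    using cInf_less_iff[OF ne bb, of "d + 1 / Suc n"] by (auto simp: d_def[symmetric])
  then obtain u where u: "\<And>n. u n \<in> V" "\<And>n. F (u n) < d + 1 / Suc n"
    by metis
  \<comment> \<open>The midpoint of \<open>v\<close> and \<open>w\<close> also lies in
    \<open>V\<close>, so \<open>F\<close> is at least \<open>d\<close> there; the parallelogram
    identity then bounds the distance of two near-minimisers by their excess over
    \<open>d\<close>.\<close>
  have par: "m * (norm (v - w))\<^sup>2 \<le> 2 * (F v - d) + 2 * (F w - d)" if "v \<in> V" "w \<in> V" for v w
  proof -
    have "(1/2) *\<^sub>R (v + w) \<in> V" "v - w \<in> V"
      using that V(1) by (auto intro: subspace_scale subspace_add subspace_diff)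
    then have "4 * d \<le> 4 * F ((1/2) *\<^sub>R (v + w))" "m * (norm (v - w))\<^sup>2 \<le> b (v - w) (v - w)"
      using d_le m(2) by auto
    moreover have "4 * F ((1/2) *\<^sub>R (v + w)) + b (v - w) (v - w) = 2 * F v + 2 * F w"
      by (simp add: F_def b.add_left b.add_right b.diff_left b.diff_right b.scaleR_left
          b.scaleR_right phi.scaleR phi.add algebra_simps)
    ultimately have "4 * d + m * (norm (v - w))\<^sup>2 \<le> 2 * F v + 2 * F w" by (metis add_mono)
    then show ?thesis by simp
  qed
  have "Cauchy u"
  proof (rule metric_CauchyI)
    fix e :: real assume "0 < e"
    \<comment> \<open>From \<open>M\<close> on the excess over \<open>d\<close> is below
      \<open>m * e\<^sup>2 / 4\<close>, so each of the two terms in \<open>par\<close> contributes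
      less than \<open>m * e\<^sup>2 / 2\<close>.\<close>
    then obtain M :: nat where M: "4 / (m * e\<^sup>2) < M" using reals_Archimedean2 by blast
    have less: "2 * (F (u n) - d) < m * e\<^sup>2 / 2" if "n \<ge> M" for n
    proof -
      have "4 / (m * e\<^sup>2) < Suc n" using M that by linarith
      then have "1 / Suc n < m * e\<^sup>2 / 4" using m(1) \<open>0 < e\<close> by (simp add: field_simps)
      with u(2)[of n] have "F (u n) < d + m * e\<^sup>2 / 4" by (meson add_strict_left_mono less_trans)
      then show ?thesis by (simp add: field_simps)
    qed
    have "dist (u n) (u k) < e" if "n \<ge> M" "k \<ge> M" for n k
    proof -
      have "m * (norm (u n - u k))\<^sup>2 < m * e\<^sup>2"
        using par[OF u(1)[of n] u(1)[of k]] less[OF that(1)] less[OF that(2)] by linarith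
      then have "(norm (u n - u k))\<^sup>2 < e\<^sup>2" using m(1) by simp
      then show ?thesis using \<open>0 < e\<close> by (simp add: dist_norm power_less_imp_less_base)
    qed
    then show "\<exists>M. \<forall>n\<ge>M. \<forall>k\<ge>M. dist (u n) (u k) < e" by blast
  qed
  then obtain l where l: "u \<longlonglongrightarrow> l"
    using Cauchy_convergent_iff convergentD by blast
  have lV: "l \<in> V" using V(2) l u(1) closed_sequentially by blast
  have "(\<lambda>n. F (u n)) \<longlonglongrightarrow> F l"
    unfolding F_def by (intro tendsto_intros b.tendsto phi.tendsto l)
  moreover have "(\<lambda>n. d + 1 / Suc n) \<longlonglongrightarrow> d + 0"
    by (intro tendsto_intros LIMSEQ_Suc[OF lim_1_over_n])
  ultimately have Fl: "F l \<le> d"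
    using LIMSEQ_le[of "\<lambda>n. F (u n)" "F l" "\<lambda>n. d + 1 / Suc n" "d + 0"] less_imp_le[OF u(2)] by auto
  have "b l v = \<phi> v" if "v \<in> V" for v
  proof (rule ccontr)
    define c where "c = b l v - \<phi> v"
    assume "b l v \<noteq> \<phi> v"
    then have "c \<noteq> 0" by (simp add: c_def)
    have "b v v \<ge> 0" using m(2)[OF that] m(1) by (meson order_trans mult_nonneg_nonneg less_imp_le zero_le_power2)
    \<comment> \<open>A step against the derivative \<open>2 * c\<close> of \<open>F\<close> at
      \<open>l\<close> in direction \<open>v\<close>. The \<open>+ 1\<close> makes the denominator
      positive from \<open>b v v \<ge> 0\<close> alone, and the step lowers \<open>F\<close> by
      \<open>t\<^sup>2 * (b v v + 2)\<close>.\<close>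
    define t where "t = - c / (b v v + 1)"
    have "l + t *\<^sub>R v \<in> V" using lV that V(1) by (simp add: subspace_add subspace_scale)
    then have "F l \<le> F (l + t *\<^sub>R v)" using d_le Fl by fastforce
    also have "\<dots> = F l + (2 * (t * c) + t\<^sup>2 * b v v)"
      by (simp add: F_def c_def b.add_left b.add_right b.scaleR_left b.scaleR_right
          phi.scaleR phi.add sym[of v l] algebra_simps power2_eq_square)
    finally have "0 \<le> 2 * (t * c) + t\<^sup>2 * b v v" by simp
    also have "t * c = - t\<^sup>2 * (b v v + 1)"
      using \<open>b v v \<ge> 0\<close> by (simp add: t_def power2_eq_square)
    finally have "0 \<le> - (t\<^sup>2 * (b v v + 2))" by (simp add: algebra_simps)
    moreover have "0 < t\<^sup>2 * (b v v + 2)"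
      using \<open>b v v \<ge> 0\<close> \<open>c \<noteq> 0\<close> by (simp add: t_def)
    ultimately show False by linarith
  qed
  with lV show ?thesis by blast
qed

lemma riesz_subspace:
  fixes V :: "'a::{real_inner,complete_space} set"
  assumes "subspace V" "closed V" "bounded_linear \<phi>"
  shows "\<exists>u\<in>V. \<forall>v\<in>V. inner v u = \<phi> v"
  using coercive_form_represents[OF bounded_bilinear_inner inner_commute assms(3,1,2), of 1]
  by (simp add: power2_norm_eq_inner inner_commute)

text \<open>The projection is the Riesz representative in \<open>V\<close> of the inner product with
  \<open>x\<close>. Uniqueness, which evaluates the definite description, comes from testing the
  difference of two candidates with itself.\<close>

lemma orth_proj:
  fixes V :: "'a::complex_hilbert set"
  assumes V: "csubspace V" "closed V"
  shows orth_proj_in: "orth_proj V x \<in> V"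
    and cinner_orth_proj: "v \<in> V \<Longrightarrow> cinner v (orth_proj V x) = cinner v x"
proof -
  obtain p where p: "p \<in> V" "\<And>v. v \<in> V \<Longrightarrow> inner v p = inner v x"
    using riesz_subspace[OF csubspace_imp_subspace[OF V(1)] V(2) bounded_linear_inner_left, of x] by blast
  have c: "cinner v p = cinner v x" if "v \<in> V" for v
    using cinner_eq_of_inner_eq[OF V(1), where f = "\<lambda>x. x"] p(2) that by metis
  have iff: "(\<forall>v\<in>V. cinner (x - q) v = 0) \<longleftrightarrow> (\<forall>v\<in>V. cinner v x = cinner v q)" for q
  proof -
    have "cinner (x - q) v = cnj (cinner v x - cinner v q)" for v
      using cinner_commute[of "x - q" v] cinner_add_right[of v "x - q" q] by simp
    then show ?thesis by simp
  qed
  have "orth_proj V x = p"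
    unfolding orth_proj_def iff
  proof (rule the_equality)
    show "p \<in> V \<and> (\<forall>v\<in>V. cinner v x = cinner v p)" using p(1) c by simp
  next
    fix q assume q: "q \<in> V \<and> (\<forall>v\<in>V. cinner v x = cinner v q)"
    then have "q - p \<in> V" using p(1) V(1) by (simp add: complex_vector.subspace_diff)
    then have "inner (q - p) q = inner (q - p) p"
      using q c by (simp add: inner_eq_Re_cinner)
    then have "inner (q - p) (q - p) = 0" by (simp only: inner_diff_right[of "q - p"] diff_self)
    then show "q = p" by simp
  qed
  then show "orth_proj V x \<in> V" "v \<in> V \<Longrightarrow> cinner v (orth_proj V x) = cinner v x"
    using p(1) c by auto
qed

text \<open>Riesz representation of \<open>inner (T x) y\<close> as a functional of \<open>x\<close>
  gives a candidate pointwise in \<open>y\<close>; the adjoint identity determines it uniquely and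
  so evaluates the definite description.\<close>

lemma cinner_cadjoint:
  fixes T :: "'a::complex_hilbert \<Rightarrow> 'b::complex_inner"
  assumes T: "bounded_clinear T"
  shows "cinner (T x) y = cinner x (cadjoint T y)"
proof -
  have lin: "bounded_linear T" "\<And>c x. T (c *\<^sub>C x) = c *\<^sub>C T x"
    using T by (auto simp: bounded_clinear_def)
  have "\<exists>z. \<forall>x. inner (T x) y = inner x z" for y
    using riesz_subspace[OF subspace_UNIV closed_UNIV
        bounded_linear_compose[OF bounded_linear_inner_left[of y] lin(1)]]
    unfolding ball_UNIV bex_UNIV by metis
  then obtain S where S: "\<And>x y. inner (T x) y = inner x (S y)" by metis
  have cS: "cinner (T x) y = cinner x (S y)" for x y
    using cinner_eq_of_inner_eq[OF complex_vector.subspace_UNIV, of T] lin(2) S by blast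
  have "cadjoint T = S"
    unfolding cadjoint_def
  proof (rule the_equality)
    fix S' assume S': "\<forall>x y. cinner (T x) y = cinner x (S' y)"
    show "S' = S"
    proof
      fix y
      have "inner x (S' y) = inner x (S y)" for x
        using S' cS by (simp add: inner_eq_Re_cinner)
      then have "inner (S' y - S y) (S' y - S y) = 0"
        by (simp only: inner_diff_right[of "S' y - S y"] diff_self)
      then show "S' y = S y" by simp
    qed
  qed (simp add: cS)
  then show ?thesis by (simp add: cS)
qed

section \<open>Resolvents\<close>

text \<open>As \<open>cmod z = 1\<close>, the norm of \<open>B x\<close> is at least
  \<open>(1 - onorm A) * norm x\<close>, which gives injectivity and bounds the inverse.
  Surjectivity is Banach's fixed point theorem: \<open>B x = y\<close> says that \<open>x\<close> is
  fixed by \<open>inverse z *\<^sub>C (y + A x)\<close>, a contraction with factor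
  \<open>onorm A\<close>.\<close>

lemma resolvent_unit_circle:
  fixes A :: "'a::complex_hilbert \<Rightarrow> 'a"
  assumes A: "bounded_clinear A" "onorm A < 1" and z: "cmod z = 1"
  defines "B \<equiv> \<lambda>x. z *\<^sub>C x - A x"
  shows "bij B" and "bounded_clinear B" and "bounded_clinear (inv B)"
proof -
  have lin: "bounded_linear A" "\<And>c x. A (c *\<^sub>C x) = c *\<^sub>C A x"
    using A(1) by (auto simp: bounded_clinear_def)
  interpret A: bounded_linear A by fact
  have nA: "norm (A x) \<le> onorm A * norm x" for x by (rule onorm[OF lin(1)])
  have zz: "z \<noteq> 0" using z by auto
  show B: "bounded_clinear B"
    unfolding bounded_clinear_def B_def
    by (auto intro!: bounded_linear_sub bounded_linear_scaleC lin
        simp: lin(2) complex_vector.scale_right_diff_distrib scaleC_scaleC mult.commute)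
  then interpret B: bounded_linear B by (simp add: bounded_clinear_def)
  have lower: "(1 - onorm A) * norm x \<le> norm (B x)" for x
    using norm_triangle_ineq2[of "z *\<^sub>C x" "A x"] nA[of x]
    by (simp add: B_def norm_scaleC z algebra_simps)
  have "inj B"
      unfolding linear_injective_0[OF B.linear_axioms]
  proof safe
    fix x assume "B x = 0"
    then have "(1 - onorm A) * norm x \<le> 0" using lower[of x] by simp
    then show "x = 0" using A(2) by (simp add: mult_le_0_iff)
  qed
  moreover have "surj B"
  proof (rule surjI)
    fix y
    have "dist (inverse z *\<^sub>C (y + A u)) (inverse z *\<^sub>C (y + A v)) \<le> onorm A * dist u v" for u v
      using nA[of "u - v"] z
      by (simp add: dist_norm complex_vector.scale_right_diff_distrib[symmetric]
          norm_scaleC A.diff[symmetric] norm_inverse)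
    then obtain x where "inverse z *\<^sub>C (y + A x) = x"
      using banach_fix_type[OF onorm_pos_le[OF lin(1)] A(2), of "\<lambda>x. inverse z *\<^sub>C (y + A x)"]
      by blast
    then have "z *\<^sub>C x = z *\<^sub>C inverse z *\<^sub>C (y + A x)" by simp
    also have "\<dots> = y + A x"
      by (simp only: scaleC_scaleC right_inverse[OF zz] complex_vector.scale_one)
    finally have "z *\<^sub>C x = y + A x" .
    then have "B x = y" by (simp only: B_def add_diff_cancel_right')
    then show "B (SOME x. B x = y) = y" by (rule someI)
  qed
  ultimately show bij: "bij B" by (simp add: bij_def)
  have BI: "B (inv B y) = y" for y using bij by (simp add: bij_is_surj surj_f_inv_f)
  have IB: "inv B (B y) = y" for y using bij by (simp add: bij_is_inj)
  have Bc: "B (c *\<^sub>C x) = c *\<^sub>C B x" for c x using B by (simp add: bounded_clinear_def)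
  have ic: "inv B (c *\<^sub>C x) = c *\<^sub>C inv B x" for c x
    by (metis BI IB Bc)
  have "bounded_linear (inv B)"
  proof (rule bounded_linear_intro[where K = "1 / (1 - onorm A)"])
    show "inv B (x + y) = inv B x + inv B y" for x y
      by (metis BI IB B.add)
    show "inv B (r *\<^sub>R x) = r *\<^sub>R inv B x" for r x
      by (simp add: scaleR_scaleC ic)
    show "norm (inv B x) \<le> norm x * (1 / (1 - onorm A))" for x
      using lower[of "inv B x"] A(2) by (simp add: BI field_simps)
  qed
  with ic show "bounded_clinear (inv B)" by (simp add: bounded_clinear_def)
qed

section \<open>The analysis operator and its bounded left inverse\<close>

lemma ell2_add: "a \<in> ell2 J \<Longrightarrow> b \<in> ell2 J \<Longrightarrow> (\<lambda>j. a j + b j) \<in> ell2 J"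
proof -
  assume a: "a \<in> ell2 J" and b: "b \<in> ell2 J"
  have "(\<lambda>j. (cmod (a j + b j))\<^sup>2) summable_on J"
  proof (rule summable_on_comparison_test)
    show "(\<lambda>j. 2 * (cmod (a j))\<^sup>2 + 2 * (cmod (b j))\<^sup>2) summable_on J"
      using a b by (intro summable_on_add summable_on_cmult_right) (auto simp: ell2_def)
    fix j
    have "(cmod (a j + b j))\<^sup>2 \<le> (cmod (a j) + cmod (b j))\<^sup>2"
      by (simp add: norm_triangle_ineq power_mono)
    also have "\<dots> \<le> 2 * (cmod (a j))\<^sup>2 + 2 * (cmod (b j))\<^sup>2"
      using sum_squares_bound[of "cmod (a j)" "cmod (b j)"] by (simp add: power2_sum)
    finally show "(cmod (a j + b j))\<^sup>2 \<le> 2 * (cmod (a j))\<^sup>2 + 2 * (cmod (b j))\<^sup>2" .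
  qed auto
  with a b show ?thesis by (simp add: ell2_def)
qed

lemma ell2_scale: "a \<in> ell2 J \<Longrightarrow> (\<lambda>j. c * a j) \<in> ell2 J"
  by (auto simp: ell2_def norm_mult power_mult_distrib intro: summable_on_cmult_right)

lemma ell2_diff: "a \<in> ell2 J \<Longrightarrow> b \<in> ell2 J \<Longrightarrow> (\<lambda>j. a j - b j) \<in> ell2 J"
  using ell2_add[of a J "\<lambda>j. -1 * b j"] ell2_scale[of b J "-1"] by simp

lemma ell2_norm_nonneg: "0 \<le> ell2_norm J a"
  by (simp add: ell2_norm_def infsum_nonneg)

lemma ell2_norm_square: "(ell2_norm J a)\<^sup>2 = (\<Sum>\<^sub>\<infinity>j\<in>J. (cmod (a j))\<^sup>2)"
  by (simp add: ell2_norm_def infsum_nonneg)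

definition ell2_inner :: "'j set \<Rightarrow> ('j \<Rightarrow> complex) \<Rightarrow> ('j \<Rightarrow> complex) \<Rightarrow> complex"
  where "ell2_inner J a b = (\<Sum>\<^sub>\<infinity>j\<in>J. a j * cnj (b j))"

text \<open>Cauchy-Schwarz on finite subsets of \<open>J\<close>, with a bound independent of the
  subset, yields absolute summability and the norm estimate together.\<close>

lemma
  assumes a: "a \<in> ell2 J" and b: "b \<in> ell2 J"
  shows ell2_inner_summable: "(\<lambda>j. a j * cnj (b j)) summable_on J"
    and cmod_ell2_inner_le: "cmod (ell2_inner J a b) \<le> ell2_norm J a * ell2_norm J b"
proof -
  have fin: "(\<Sum>j\<in>F. norm (a j * cnj (b j))) \<le> ell2_norm J a * ell2_norm J b"
    if "finite F" "F \<subseteq> J" for F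
  proof -
    have L: "L2_set (\<lambda>j. cmod (c j)) F \<le> ell2_norm J c" if "c \<in> ell2 J" for c
      using \<open>c \<in> ell2 J\<close> \<open>finite F\<close> \<open>F \<subseteq> J\<close>
      by (auto simp: L2_set_def ell2_norm_def ell2_def intro!: finite_sum_le_infsum)
    have "(\<Sum>j\<in>F. norm (a j * cnj (b j))) \<le> L2_set (\<lambda>j. cmod (a j)) F * L2_set (\<lambda>j. cmod (b j)) F"
      using L2_set_mult_ineq[of "\<lambda>j. cmod (a j)" "\<lambda>j. cmod (b j)" F] by (simp add: norm_mult)
    also have "\<dots> \<le> ell2_norm J a * ell2_norm J b"
      using L[OF a] L[OF b] by (intro mult_mono) (auto simp: ell2_norm_nonneg)
    finally show ?thesis .
  qed
  have abs: "(\<lambda>j. norm (a j * cnj (b j))) summable_on J"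
    by (rule nonneg_bdd_above_summable_on) (auto intro!: bdd_aboveI2[where M = "ell2_norm J a * ell2_norm J b"] fin)
  then show "(\<lambda>j. a j * cnj (b j)) summable_on J" by (rule abs_summable_summable)
  have "cmod (ell2_inner J a b) \<le> (\<Sum>\<^sub>\<infinity>j\<in>J. norm (a j * cnj (b j)))"
    unfolding ell2_inner_def by (rule norm_infsum_bound[OF abs])
  also have "\<dots> \<le> ell2_norm J a * ell2_norm J b"
    by (rule infsum_le_finite_sums[OF abs fin])
  finally show "cmod (ell2_inner J a b) \<le> ell2_norm J a * ell2_norm J b" .
qed

lemma ell2_inner_add_left:
  "a \<in> ell2 J \<Longrightarrow> b \<in> ell2 J \<Longrightarrow> c \<in> ell2 J \<Longrightarrow>
    ell2_inner J (\<lambda>j. a j + b j) c = ell2_inner J a c + ell2_inner J b c"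
  by (simp add: ell2_inner_def distrib_right infsum_add ell2_inner_summable)

lemma ell2_inner_scale_left: "ell2_inner J (\<lambda>j. c * a j) b = c * ell2_inner J a b"
  by (simp add: ell2_inner_def mult.assoc infsum_cmult_right')

lemma ell2_inner_commute: "ell2_inner J a b = cnj (ell2_inner J b a)"
  by (simp add: ell2_inner_def mult.commute flip: infsum_cnj)

lemma ell2_inner_add_right:
  "a \<in> ell2 J \<Longrightarrow> b \<in> ell2 J \<Longrightarrow> c \<in> ell2 J \<Longrightarrow>
    ell2_inner J a (\<lambda>j. b j + c j) = ell2_inner J a b + ell2_inner J a c"
  by (simp add: ell2_inner_commute[of J a] ell2_inner_add_left)

lemma ell2_inner_scale_right: "ell2_inner J a (\<lambda>j. c * b j) = cnj c * ell2_inner J a b"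
  by (simp add: ell2_inner_commute[of J a] ell2_inner_scale_left)

lemma ell2_inner_self:
  assumes "a \<in> ell2 J"
  shows "ell2_inner J a a = complex_of_real ((ell2_norm J a)\<^sup>2)"
proof -
  have "((\<lambda>j. (cmod (a j))\<^sup>2) has_sum (ell2_norm J a)\<^sup>2) J"
    unfolding ell2_norm_square using assms by (intro has_sum_infsum) (simp add: ell2_def)
  then have "((\<lambda>j. complex_of_real ((cmod (a j))\<^sup>2)) has_sum of_real ((ell2_norm J a)\<^sup>2)) J"
    by (simp only: has_sum_of_real_iff)
  then show ?thesis
    by (simp only: ell2_inner_def infsumI complex_norm_square)
qed

text \<open>The analysis operator of frame theory. Cutting off outside \<open>J\<close> makes its
  values elements of \<open>ell2 J\<close> for Bessel families, and literally the rows of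
  \<open>sample_matrix\<close>.\<close>

definition analysis :: "'j set \<Rightarrow> ('j \<Rightarrow> 'a::complex_inner) \<Rightarrow> 'a \<Rightarrow> 'j \<Rightarrow> complex"
  where "analysis J f v = (\<lambda>j. if j \<in> J then cinner v (f j) else 0)"

lemma analysis_add: "analysis J f (u + v) = (\<lambda>j. analysis J f u j + analysis J f v j)"
  by (auto simp: analysis_def cinner_add_left)

lemma analysis_scale: "analysis J f (c *\<^sub>C v) = (\<lambda>j. c * analysis J f v j)"
  by (auto simp: analysis_def cinner_scaleC_left)

lemma ell2_norm_analysis_square:
  "(ell2_norm J (analysis J f v))\<^sup>2 = (\<Sum>\<^sub>\<infinity>j\<in>J. (cmod (cinner v (f j)))\<^sup>2)"
  unfolding ell2_norm_square by (rule infsum_cong) (simp add: analysis_def)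

lemma analysis_ell2: "bessel_sequence J f \<Longrightarrow> analysis J f v \<in> ell2 J"
  unfolding bessel_sequence_def ell2_def
  by (auto simp: analysis_def cong: summable_on_cong)

lemma analysis_bounded:
  assumes "bessel_sequence J f"
  obtains K where "0 \<le> K" and "\<And>v. ell2_norm J (analysis J f v) \<le> K * norm v"
proof -
  obtain C where C: "C > 0" "\<And>v. (\<Sum>\<^sub>\<infinity>j\<in>J. (cmod (cinner v (f j)))\<^sup>2) \<le> C * (norm v)\<^sup>2"
    using assms unfolding bessel_sequence_def by metis
  have "ell2_norm J (analysis J f v) \<le> sqrt C * norm v" for v
    by (rule power2_le_imp_le)
      (use C in \<open>auto simp: ell2_norm_analysis_square power_mult_distrib\<close>)
  then show ?thesis using that[of "sqrt C"] C(1) by simp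
qed

text \<open>
  \<open>L a\<close> is the least squares solution of \<open>analysis J f u = a\<close>, characterised by its normal
  equation; this avoids completeness of \<open>\<ell>\<^sup>2\<close>.
\<close>

lemma analysis_left_inverse:
  fixes f :: "'j \<Rightarrow> 'a::complex_hilbert"
  assumes f: "bessel_sequence J f" and W: "csubspace W" "closed W"
    and m: "0 < m" "\<And>v. v \<in> W \<Longrightarrow> m * (norm v)\<^sup>2 \<le> (ell2_norm J (analysis J f v))\<^sup>2"
  obtains L K where
    "\<And>a. a \<in> ell2 J \<Longrightarrow> L a \<in> W"
    "\<And>a b. a \<in> ell2 J \<Longrightarrow> b \<in> ell2 J \<Longrightarrow> L (\<lambda>j. a j + b j) = L a + L b"
    "\<And>a c. a \<in> ell2 J \<Longrightarrow> L (\<lambda>j. c * a j) = c *\<^sub>C L a"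
    "0 \<le> K" "\<And>a. a \<in> ell2 J \<Longrightarrow> norm (L a) \<le> K * ell2_norm J a"
    "\<And>v. v \<in> W \<Longrightarrow> L (analysis J f v) = v"
proof -
  let ?C = "analysis J f"
  note [simp] = analysis_ell2[OF f]
  obtain M where M: "0 \<le> M" "\<And>v. ell2_norm J (?C v) \<le> M * norm v"
    using analysis_bounded[OF f] by blast
  have CR: "?C (r *\<^sub>R v) = (\<lambda>j. of_real r * ?C v j)" for r v
    by (simp add: scaleR_scaleC analysis_scale)
  have Re_le: "\<bar>Re (ell2_inner J a (?C v))\<bar> \<le> ell2_norm J a * (M * norm v)" if "a \<in> ell2 J" for a v
    using abs_Re_le_cmod[of "ell2_inner J a (?C v)"] cmod_ell2_inner_le[OF that, of "?C v"]
      mult_left_mono[OF M(2)[of v] ell2_norm_nonneg[of J a]] by simp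
  have functional: "bounded_linear (\<lambda>v. Re (ell2_inner J a (?C v)))" if "a \<in> ell2 J" for a
  proof (rule bounded_linear_intro[where K = "ell2_norm J a * M"])
    show "norm (Re (ell2_inner J a (?C v))) \<le> norm v * (ell2_norm J a * M)" for v
      using Re_le[OF that, of v] by (simp add: mult_ac)
  qed (auto simp: analysis_add CR ell2_inner_add_right ell2_inner_scale_right that)
  \<comment> \<open>The real part makes the form symmetric and real bilinear; its coercivity on
    \<open>W\<close> is exactly the lower bound \<open>m\<close>.\<close>
  have form: "bounded_bilinear (\<lambda>u v. Re (ell2_inner J (?C u) (?C v)))"
  proof
    show "\<exists>K. \<forall>u v. norm (Re (ell2_inner J (?C u) (?C v))) \<le> norm u * norm v * K"
    proof (intro exI allI)
      fix u v
      have "norm (Re (ell2_inner J (?C u) (?C v))) \<le> ell2_norm J (?C u) * (M * norm v)"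
        using Re_le[of "?C u" v] by simp
      also have "\<dots> \<le> (M * norm u) * (M * norm v)"
        using M by (intro mult_right_mono) auto
      finally show "norm (Re (ell2_inner J (?C u) (?C v))) \<le> norm u * norm v * (M * M)"
        by (simp add: mult_ac)
    qed
  qed (auto simp: analysis_add CR ell2_inner_add_right ell2_inner_scale_right
      ell2_inner_add_left ell2_inner_scale_left)
  \<comment> \<open>The normal equation of the least squares problem, stated for real parts to fit
    the real minimisation principle. Uniqueness makes \<open>L\<close> additive, since sums of
    solutions solve the summed equation.\<close>
  define sol where "sol a u \<longleftrightarrow> u \<in> W \<and>
    (\<forall>v\<in>W. Re (ell2_inner J (?C u) (?C v)) = Re (ell2_inner J a (?C v)))" for a u
  have ex: "\<exists>u. sol a u" if "a \<in> ell2 J" for a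
    unfolding sol_def Bex_def[symmetric]
  proof (rule coercive_form_represents[OF form _ functional[OF that]
        csubspace_imp_subspace[OF W(1)] W(2) m(1)])
    show "Re (ell2_inner J (?C u) (?C v)) = Re (ell2_inner J (?C v) (?C u))" for u v
      using ell2_inner_commute[of J "?C u" "?C v"] by simp
  qed (use m(2) in \<open>simp add: ell2_inner_self\<close>)
  have unique: "u = u'" if "sol a u" "sol a u'" for a u u'
  proof -
    have d: "u - u' \<in> W" using that W(1) by (simp add: sol_def complex_vector.subspace_diff)
    have "Re (ell2_inner J (?C u) (?C (u - u'))) = Re (ell2_inner J (?C u') (?C (u - u')))"
      using that d by (simp add: sol_def)
    then have "Re (ell2_inner J (?C (u - u')) (?C (u - u'))) = 0"
      by (simp add: bounded_bilinear.diff_left[OF form])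
    then have "m * (norm (u - u'))\<^sup>2 \<le> 0" using m(2)[OF d] by (simp add: ell2_inner_self)
    then show ?thesis using m(1) by (simp add: mult_le_0_iff)
  qed
  define L where "L a = (THE u. sol a u)" for a
  have L: "sol a (L a)" if "a \<in> ell2 J" for a
    unfolding L_def using ex[OF that] unique by (metis theI)
  have L_eq: "L a = u" if "sol a u" for a u
    unfolding L_def using that unique by blast
  show ?thesis
  proof (rule that[of L "M / m"])
    show "L a \<in> W" if "a \<in> ell2 J" for a using L[OF that] by (simp add: sol_def)
    show "L (\<lambda>j. a j + b j) = L a + L b" if "a \<in> ell2 J" "b \<in> ell2 J" for a b
      using L[OF that(1)] L[OF that(2)] W(1) that
      by (intro L_eq) (auto simp: sol_def analysis_add ell2_inner_add_left complex_vector.subspace_add)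
    show "L (\<lambda>j. c * a j) = c *\<^sub>C L a" if "a \<in> ell2 J" for a c
    proof (rule L_eq)
      have "Re (ell2_inner J (?C (c *\<^sub>C L a)) (?C v)) = Re (ell2_inner J (\<lambda>j. c * a j) (?C v))"
        if v: "v \<in> W" for v
      proof -
        \<comment> \<open>The scalar \<open>c\<close> is moved to the test vector, which stays in
          the complex subspace \<open>W\<close>; so the equation for real parts already gives
          complex homogeneity.\<close>
        have "cnj c *\<^sub>C v \<in> W" using v W(1) by (simp add: complex_vector.subspace_scale)
        then have "Re (ell2_inner J (?C (L a)) (?C (cnj c *\<^sub>C v))) = Re (ell2_inner J a (?C (cnj c *\<^sub>C v)))"
          using L[OF \<open>a \<in> ell2 J\<close>] by (auto simp: sol_def)
        then show ?thesis
          by (simp only: analysis_scale ell2_inner_scale_left ell2_inner_scale_right complex_cnj_cnj)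
      qed
      then show "sol (\<lambda>j. c * a j) (c *\<^sub>C L a)"
        using L[OF that] W(1) by (simp add: sol_def complex_vector.subspace_scale)
    qed
    show "L (?C v) = v" if "v \<in> W" for v
      using that by (intro L_eq) (simp add: sol_def)
    show "norm (L a) \<le> M / m * ell2_norm J a" if "a \<in> ell2 J" for a
    proof (cases "L a = 0")
      case False
      \<comment> \<open>Testing the normal equation with its own solution and applying
        Cauchy-Schwarz gives \<open>m * (norm (L a))\<^sup>2 \<le> M * ell2_norm J a * norm (L
        a)\<close>, hence the constant \<open>M / m\<close>.\<close>
      have "m * (norm (L a))\<^sup>2 \<le> Re (ell2_inner J (?C (L a)) (?C (L a)))"
        using m(2) L[OF that] by (simp add: sol_def ell2_inner_self)
      also have "\<dots> = Re (ell2_inner J a (?C (L a)))"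
        using L[OF that] by (simp add: sol_def)
      also have "\<dots> \<le> ell2_norm J a * (M * norm (L a))"
        using Re_le[OF that, of "L a"] by simp
      finally show ?thesis
        using False m(1) by (simp add: power2_eq_square field_simps)
    qed (use M m in \<open>simp add: ell2_norm_nonneg\<close>)
  qed (use M m in auto)
qed

section \<open>Roots of unity\<close>

text \<open>Written with the very expression used in \<open>resolvent_root\<close>, so that
  unfolding identifies the two.\<close>

definition unit_root :: "nat \<Rightarrow> nat \<Rightarrow> complex"
  where "unit_root N s = exp (2 * of_real pi * \<i> * of_nat s / of_nat N)"

lemma cmod_unit_root [simp]: "cmod (unit_root N s) = 1"
  by (simp add: unit_root_def)

lemma unit_root_power_swap: "unit_root N s ^ l = unit_root N l ^ s"
  by (simp add: unit_root_def exp_of_nat_mult[symmetric] mult_ac)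

lemma unit_root_power_N: "N \<ge> 1 \<Longrightarrow> unit_root N s ^ N = 1"
  unfolding unit_root_def by (rule complex_root_unity) simp

lemma unit_root_power_periodic: "N \<ge> 1 \<Longrightarrow> unit_root N s ^ (N * k + l) = unit_root N s ^ l"
  by (simp add: power_add power_mult unit_root_power_N)

text \<open>A geometric sum whose ratio is an \<open>N\<close>-th root of unity, equal to
  \<open>1\<close> only for \<open>s = t\<close>.\<close>

lemma sum_unit_root_orthogonal:
  assumes "s < N" "t < N"
  shows "(\<Sum>l<N. unit_root N s ^ l * cnj (unit_root N t) ^ l) = (if s = t then of_nat N else 0)"
proof -
  define z where "z = unit_root N s * cnj (unit_root N t)"
  have inv: "unit_root N t * cnj (unit_root N t) = 1"
    by (simp add: complex_norm_square[symmetric])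
  have "z = 1 \<longleftrightarrow> unit_root N s = unit_root N t"
    using inv unfolding z_def by (metis mult.commute mult_1 mult.assoc)
  also have "\<dots> \<longleftrightarrow> s = t"
    using complex_root_unity_eq[of N s t] assms by (simp add: unit_root_def)
  finally have z1: "z = 1 \<longleftrightarrow> s = t" .
  have zN: "z ^ N = 1"
    using assms by (simp add: z_def power_mult_distrib unit_root_power_N complex_cnj_power[symmetric]
        del: complex_cnj_power)
  have "(\<Sum>l<N. unit_root N s ^ l * cnj (unit_root N t) ^ l) = (\<Sum>l<N. z ^ l)"
    by (simp add: z_def power_mult_distrib)
  also have "\<dots> = (if s = t then of_nat N else 0)"
    by (simp add: sum_gp_strict z1 zN)
  finally show ?thesis .
qed

text \<open>Index and exponent of a root can be exchanged, which turns a sum over roots into a sum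
  over exponents.\<close>

lemma sum_unit_root_orthogonal_dual:
  assumes "i < N" "l < N"
  shows "(\<Sum>s<N. unit_root N s ^ i * cnj (unit_root N s) ^ l) = (if i = l then of_nat N else 0)"
proof -
  have "unit_root N s ^ i * cnj (unit_root N s) ^ l = unit_root N i ^ s * cnj (unit_root N l) ^ s" for s
    by (simp only: unit_root_power_swap[of N s] complex_cnj_power[symmetric])
  then show ?thesis using sum_unit_root_orthogonal[OF assms] by simp
qed

section \<open>The discrete Fourier transform\<close>

text \<open>The factor \<open>1 / N\<close> is placed here, so the value at \<open>s\<close> is the
  coefficient of the exponential \<open>unit_root N s ^ n\<close> in the \<open>N\<close>-periodic
  sequence through \<open>w 0, ..., w (N - 1)\<close>.\<close>

definition dft :: "nat \<Rightarrow> (nat \<Rightarrow> 'a::complex_inner) \<Rightarrow> nat \<Rightarrow> 'a"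
  where "dft N w s = (1 / of_nat N) *\<^sub>C (\<Sum>i<N. cnj (unit_root N s) ^ i *\<^sub>C w i)"

definition idft :: "nat \<Rightarrow> (nat \<Rightarrow> 'a::complex_inner) \<Rightarrow> nat \<Rightarrow> 'a"
  where "idft N c n = (\<Sum>s<N. unit_root N s ^ n *\<^sub>C c s)"

lemma idft_dft:
  fixes w :: "nat \<Rightarrow> 'a::complex_inner"
  assumes "i < N"
  shows "idft N (dft N w) i = w i"
proof -
  have "idft N (dft N w) i =
    (\<Sum>s<N. \<Sum>l<N. (1 / of_nat N * (unit_root N s ^ i * cnj (unit_root N s) ^ l)) *\<^sub>C w l)"
    by (simp add: idft_def dft_def complex_vector.scale_sum_right scaleC_scaleC mult_ac)
  also have "\<dots> = (\<Sum>l<N. (1 / of_nat N * (\<Sum>s<N. unit_root N s ^ i * cnj (unit_root N s) ^ l)) *\<^sub>C w l)"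
    unfolding sum_distrib_left complex_vector.scale_sum_left by (rule sum.swap)
  also have "\<dots> = (\<Sum>l<N. if i = l then w l else 0)"
  proof (rule sum.cong)
    fix l assume "l \<in> {..<N}"
    then have "l < N" by simp
    then show "(1 / of_nat N * (\<Sum>s<N. unit_root N s ^ i * cnj (unit_root N s) ^ l)) *\<^sub>C w l =
        (if i = l then w l else 0)"
      using assms by (simp only: sum_unit_root_orthogonal_dual) simp
  qed simp
  also have "\<dots> = w i" using assms by simp
  finally show ?thesis .
qed

lemma dft_idft:
  fixes c :: "nat \<Rightarrow> 'a::complex_inner"
  assumes "s < N"
  shows "dft N (idft N c) s = c s"
proof -
  have "dft N (idft N c) s =
    (\<Sum>l<N. \<Sum>t<N. (1 / of_nat N * (unit_root N t ^ l * cnj (unit_root N s) ^ l)) *\<^sub>C c t)"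
    by (simp add: idft_def dft_def complex_vector.scale_sum_right scaleC_scaleC mult_ac)
  also have "\<dots> = (\<Sum>t<N. (1 / of_nat N * (\<Sum>l<N. unit_root N t ^ l * cnj (unit_root N s) ^ l)) *\<^sub>C c t)"
    unfolding sum_distrib_left complex_vector.scale_sum_left by (rule sum.swap)
  also have "\<dots> = (\<Sum>t<N. if t = s then c t else 0)"
  proof (rule sum.cong)
    fix t assume "t \<in> {..<N}"
    then have "t < N" by simp
    then show "(1 / of_nat N * (\<Sum>l<N. unit_root N t ^ l * cnj (unit_root N s) ^ l)) *\<^sub>C c t =
        (if t = s then c t else 0)"
      using assms by (simp only: sum_unit_root_orthogonal) simp
  qed simp
  also have "\<dots> = c s" using assms by simp
  finally show ?thesis .
qed

lemma dft_add: "dft N (\<lambda>i. v i + w i) s = dft N v s + dft N w s"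
  by (simp add: dft_def scaleC_add_right sum.distrib)

lemma idft_add: "idft N (\<lambda>s. b s + c s) n = idft N b n + idft N c n"
  by (simp add: idft_def scaleC_add_right sum.distrib)

lemma dft_scale: "dft N (\<lambda>i. z *\<^sub>C w i) s = z *\<^sub>C dft N w s"
  by (simp add: dft_def complex_vector.scale_sum_right scaleC_scaleC mult_ac)

lemma idft_scale: "idft N (\<lambda>s. z *\<^sub>C c s) n = z *\<^sub>C idft N c n"
  by (simp add: idft_def complex_vector.scale_sum_right scaleC_scaleC mult_ac)

lemma dft_cong: "(\<And>i. i < N \<Longrightarrow> v i = w i) \<Longrightarrow> dft N v s = dft N w s"
  by (simp add: dft_def)

lemma idft_cong: "(\<And>s. s < N \<Longrightarrow> b s = c s) \<Longrightarrow> idft N b n = idft N c n"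
  by (simp add: idft_def)

lemma dft_in: "csubspace W \<Longrightarrow> (\<And>i. i < N \<Longrightarrow> w i \<in> W) \<Longrightarrow> dft N w s \<in> W"
  by (auto simp: dft_def intro!: complex_vector.subspace_scale complex_vector.subspace_sum)

lemma idft_in: "csubspace W \<Longrightarrow> (\<And>s. s < N \<Longrightarrow> c s \<in> W) \<Longrightarrow> idft N c n \<in> W"
  by (auto simp: idft_def intro!: complex_vector.subspace_scale complex_vector.subspace_sum)

lemma norm_dft_le: "norm (dft N w s) \<le> (\<Sum>i<N. norm (w i))"
proof (cases "N = 0")
  case False
  have "norm (dft N w s) \<le> (1 / N) * (\<Sum>i<N. norm (w i))"
    unfolding dft_def norm_scaleC
    by (auto simp: norm_divide norm_scaleC norm_power intro!: divide_right_mono sum_norm_le)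
  also have "\<dots> \<le> 1 * (\<Sum>i<N. norm (w i))"
    using False by (intro mult_right_mono sum_nonneg) auto
  finally show ?thesis by simp
qed (simp add: dft_def)

lemma norm_idft_le: "norm (idft N c n) \<le> (\<Sum>s<N. norm (c s))"
  unfolding idft_def by (rule sum_norm_le) (simp add: norm_scaleC norm_power)

text \<open>This interchange lets a left inverse act on rows before their frequencies are
  separated.\<close>

lemma clinear_dft:
  assumes "bounded_clinear F"
  shows "F (dft N w s) = dft N (\<lambda>i. F (w i)) s"
proof -
  have F: "bounded_linear F" "\<And>c x. F (c *\<^sub>C x) = c *\<^sub>C F x"
    using assms by (auto simp: bounded_clinear_def)
  show ?thesis
    by (simp add: dft_def F(2) linear_sum[OF bounded_linear.linear[OF F(1)]])
qed

lemma clinear_idft: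
  assumes "bounded_clinear F"
  shows "F (idft N c n) = idft N (\<lambda>s. F (c s)) n"
proof -
  have F: "bounded_linear F" "\<And>c x. F (c *\<^sub>C x) = c *\<^sub>C F x"
    using assms by (auto simp: bounded_clinear_def)
  show ?thesis
    by (simp add: idft_def F(2) linear_sum[OF bounded_linear.linear[OF F(1)]])
qed

lemma idft_periodic: "N \<ge> 1 \<Longrightarrow> idft N c (N * k + l) = idft N c l"
  by (simp add: idft_def unit_root_power_periodic)

section \<open>Steady states\<close>

lemma resolvent_root:
  fixes A :: "'a::complex_hilbert \<Rightarrow> 'a"
  assumes A: "bounded_clinear A" "onorm A < 1"
  shows bounded_clinear_resolvent_root: "bounded_clinear (resolvent_root A N s)"
    and resolvent_root_right: "unit_root N s *\<^sub>C resolvent_root A N s v - A (resolvent_root A N s v) = v"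
    and resolvent_root_left: "resolvent_root A N s (unit_root N s *\<^sub>C v - A v) = v"
    and bounded_clinear_shift: "bounded_clinear (\<lambda>x. unit_root N s *\<^sub>C x - A x)"
proof -
  note R = resolvent_unit_circle[OF A, of "unit_root N s"]
  have T: "resolvent_root A N s = inv (\<lambda>x. unit_root N s *\<^sub>C x - A x)"
    by (simp add: resolvent_root_def unit_root_def)
  show "bounded_clinear (resolvent_root A N s)" "bounded_clinear (\<lambda>x. unit_root N s *\<^sub>C x - A x)"
    using R by (simp_all add: T)
  show "unit_root N s *\<^sub>C resolvent_root A N s v - A (resolvent_root A N s v) = v"
    unfolding T using surj_f_inv_f[OF bij_is_surj[OF R(1)], of v] by simp
  show "resolvent_root A N s (unit_root N s *\<^sub>C v - A v) = v"
    unfolding T using inv_f_f[OF bij_is_inj[OF R(1)], of v] by simp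
qed

lemma periodic_eq_idft_dft:
  assumes N: "N \<ge> 1" and per: "\<And>n. w (n + N) = w n"
  shows "w n = idft N (dft N w) n"
proof -
  have shift: "w (N * k + l) = w l" for k l
  proof (induction k)
    case (Suc k)
    then show ?case using per[of "N * k + l"] by (simp add: algebra_simps)
  qed simp
  have "w n = w (n mod N)"
    using shift[of "n div N" "n mod N"] by simp
  also have "\<dots> = idft N (dft N w) (n mod N)"
    using N by (simp add: idft_dft)
  also have "\<dots> = idft N (dft N w) n"
    using idft_periodic[OF N, of "dft N w" "n div N" "n mod N"] by simp
  finally show ?thesis .
qed

text \<open>The resolvent identity makes \<open>z\<close> a solution driven by the same input. The
  difference of two solutions obeys the homogeneous recursion and decays like
  \<open>onorm A ^ n\<close>, whatever the initial state, while \<open>z\<close> is constant along a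
  residue class.\<close>

lemma tendsto_steady_state:
  fixes A :: "'a::complex_hilbert \<Rightarrow> 'a"
  assumes A: "bounded_clinear A" "onorm A < 1" and N: "N \<ge> 1"
    and per: "\<And>n. w (n + N) = w n" and x: "\<And>n. x (Suc n) = A (x n) + w n"
  shows "(\<lambda>k. x (N * k + l)) \<longlonglongrightarrow> idft N (\<lambda>s. resolvent_root A N s (dft N w s)) l"
proof -
  have lin: "bounded_linear A" using A by (simp add: bounded_clinear_def)
  define z where "z = idft N (\<lambda>s. resolvent_root A N s (dft N w s))"
  have step: "unit_root N s *\<^sub>C resolvent_root A N s v = A (resolvent_root A N s v) + v" for s v
    using resolvent_root_right[OF A, of N s v] by (simp add: algebra_simps)
  have z: "z (Suc n) = A (z n) + w n" for n
  proof -
    have "z (Suc n) = (\<Sum>s<N. unit_root N s ^ n *\<^sub>C (A (resolvent_root A N s (dft N w s)) + dft N w s))"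
      by (simp add: z_def idft_def step[symmetric] scaleC_scaleC mult.commute)
    also have "\<dots> = A (z n) + idft N (dft N w) n"
      unfolding z_def clinear_idft[OF A(1)] by (simp add: idft_def scaleC_add_right sum.distrib)
    also have "idft N (dft N w) n = w n"
      using periodic_eq_idft_dft[OF N, of w] per by simp
    finally show ?thesis .
  qed
  have bound: "norm (x n - z n) \<le> onorm A ^ n * norm (x 0 - z 0)" for n
  proof (induction n)
    case (Suc n)
    have "norm (x (Suc n) - z (Suc n)) = norm (A (x n - z n))"
      by (simp add: x z linear_diff[OF bounded_linear.linear[OF lin]])
    also have "\<dots> \<le> onorm A * norm (x n - z n)" by (rule onorm[OF lin])
    also have "\<dots> \<le> onorm A * (onorm A ^ n * norm (x 0 - z 0))"
      by (rule mult_left_mono[OF Suc onorm_pos_le[OF lin]])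
    finally show ?case by (simp add: mult_ac)
  qed simp
  have "(\<lambda>n. onorm A ^ n * norm (x 0 - z 0)) \<longlonglongrightarrow> 0"
    using A(2) onorm_pos_le[OF lin] by (intro tendsto_mult_left_zero LIMSEQ_power_zero) simp
  then have "(\<lambda>n. x n - z n) \<longlonglongrightarrow> 0"
    by (rule Lim_null_comparison[rotated]) (simp add: bound)
  moreover have "filterlim (\<lambda>k. N * k + l) sequentially sequentially"
    using N by (intro filterlim_subseq strict_monoI) auto
  ultimately have "(\<lambda>k. x (N * k + l) - z (N * k + l)) \<longlonglongrightarrow> 0"
    by (rule filterlim_compose)
  then have "(\<lambda>k. x (N * k + l) - z l) \<longlonglongrightarrow> 0"
    by (simp add: z_def idft_periodic[OF N])
  then show ?thesis unfolding z_def by (rule Lim_null[THEN iffD2])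
qed

section \<open>Frames of projections\<close>

text \<open>For \<open>v\<close> in \<open>V\<close> the coefficients against
  \<open>orth_proj V (f j)\<close> and against \<open>f j\<close> agree, and the Bessel constant
  serves as upper frame bound.\<close>

lemma frame_of_orth_proj_iff:
  fixes f :: "'j \<Rightarrow> 'a::complex_hilbert"
  assumes f: "bessel_sequence J f" and V: "csubspace V" "closed V"
  shows "frame_of J (\<lambda>j. orth_proj V (f j)) V \<longleftrightarrow>
    (\<exists>m>0. \<forall>v\<in>V. m * (norm v)\<^sup>2 \<le> (ell2_norm J (analysis J f v))\<^sup>2)"
proof -
  obtain C where C: "C > 0" "\<And>v. (\<lambda>j. (cmod (cinner v (f j)))\<^sup>2) summable_on J"
    "\<And>v. (\<Sum>\<^sub>\<infinity>j\<in>J. (cmod (cinner v (f j)))\<^sup>2) \<le> C * (norm v)\<^sup>2"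
    using f unfolding bessel_sequence_def by metis
  have "frame_of J (\<lambda>j. orth_proj V (f j)) V \<longleftrightarrow>
    (\<exists>m M. 0 < m \<and> m \<le> M \<and> (\<forall>v\<in>V. m * (norm v)\<^sup>2 \<le> (ell2_norm J (analysis J f v))\<^sup>2 \<and>
      (ell2_norm J (analysis J f v))\<^sup>2 \<le> M * (norm v)\<^sup>2))"
    by (simp add: frame_of_def orth_proj_in[OF V] cinner_orth_proj[OF V] C(2)
        ell2_norm_analysis_square)
  also have "\<dots> \<longleftrightarrow> (\<exists>m>0. \<forall>v\<in>V. m * (norm v)\<^sup>2 \<le> (ell2_norm J (analysis J f v))\<^sup>2)"
  proof
    assume "\<exists>m>0. \<forall>v\<in>V. m * (norm v)\<^sup>2 \<le> (ell2_norm J (analysis J f v))\<^sup>2"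
    then obtain m where m: "m > 0" "\<And>v. v \<in> V \<Longrightarrow> m * (norm v)\<^sup>2 \<le> (ell2_norm J (analysis J f v))\<^sup>2"
      by blast
    \<comment> \<open>\<open>frame_of\<close> asks for ordered bounds, hence \<open>max m C\<close>
      in place of \<open>C\<close>.\<close>
    have "(ell2_norm J (analysis J f v))\<^sup>2 \<le> max m C * (norm v)\<^sup>2" for v
      unfolding ell2_norm_analysis_square
      by (rule order_trans[OF C(3)]) (simp add: mult_right_mono)
    with m show "\<exists>m M. 0 < m \<and> m \<le> M \<and>
      (\<forall>v\<in>V. m * (norm v)\<^sup>2 \<le> (ell2_norm J (analysis J f v))\<^sup>2 \<and>
      (ell2_norm J (analysis J f v))\<^sup>2 \<le> M * (norm v)\<^sup>2)"
      by (intro exI[of _ m] exI[of _ "max m C"]) simp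
  qed blast
  finally show ?thesis .
qed

lemma analysis_cadjoint:
  "bounded_clinear T \<Longrightarrow> analysis J (\<lambda>j. cadjoint T (g j)) v = analysis J g (T v)"
  for T :: "'a::complex_hilbert \<Rightarrow> 'b::complex_inner"
  by (auto simp: analysis_def cinner_cadjoint[of T])

lemma bessel_sequence_cadjoint:
  fixes T :: "'a::complex_hilbert \<Rightarrow> 'b::complex_inner"
  assumes T: "bounded_clinear T" and g: "bessel_sequence J g"
  shows "bessel_sequence J (\<lambda>j. cadjoint T (g j))"
proof -
  obtain C where C: "C > 0" "\<And>v. (\<lambda>j. (cmod (cinner v (g j)))\<^sup>2) summable_on J"
    "\<And>v. (\<Sum>\<^sub>\<infinity>j\<in>J. (cmod (cinner v (g j)))\<^sup>2) \<le> C * (norm v)\<^sup>2"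
    using g unfolding bessel_sequence_def by metis
  have "bounded_linear T" using T by (simp add: bounded_clinear_def)
  then obtain K where K: "K > 0" "\<And>v. norm (T v) \<le> norm v * K"
    using bounded_linear.pos_bounded by metis
  have "(\<Sum>\<^sub>\<infinity>j\<in>J. (cmod (cinner (T v) (g j)))\<^sup>2) \<le> (C * K\<^sup>2) * (norm v)\<^sup>2" for v
  proof -
    have "(\<Sum>\<^sub>\<infinity>j\<in>J. (cmod (cinner (T v) (g j)))\<^sup>2) \<le> C * (norm (T v))\<^sup>2" by (rule C(3))
    also have "\<dots> \<le> C * (norm v * K)\<^sup>2"
      using C(1) K(2) by (intro mult_left_mono power_mono) auto
    finally show ?thesis by (simp add: power_mult_distrib mult_ac)
  qed
  then show ?thesis
    unfolding bessel_sequence_def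
    using C K by (intro exI[of _ "C * K\<^sup>2"]) (simp add: cinner_cadjoint[OF T, symmetric])
qed

text \<open>Boundedness of \<open>F\<close> and of its left inverse \<open>G\<close> makes
  \<open>norm v\<close> and \<open>norm (F v)\<close> comparable; the squares of their bounds divide
  the constant \<open>m\<close>. It is applied to a resolvent and the operator that the resolvent
  inverts.\<close>

lemma lower_bound_image_iff:
  fixes F :: "'a::real_normed_vector \<Rightarrow> 'b::real_normed_vector"
  assumes F: "bounded_linear F" and G: "bounded_linear G" "\<And>v. G (F v) = v"
  shows "(\<exists>m>0. \<forall>u\<in>F ` W. m * (norm u)\<^sup>2 \<le> \<phi> u) \<longleftrightarrow>
    (\<exists>m>0. \<forall>v\<in>W. m * (norm v)\<^sup>2 \<le> \<phi> (F v))"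
proof -
  obtain K where K: "K > 0" "\<And>v. norm (F v) \<le> norm v * K"
    using F bounded_linear.pos_bounded by metis
  obtain K' where K': "K' > 0" "\<And>v. norm (G v) \<le> norm v * K'"
    using G(1) bounded_linear.pos_bounded by metis
  show ?thesis
  proof
    assume "\<exists>m>0. \<forall>u\<in>F ` W. m * (norm u)\<^sup>2 \<le> \<phi> u"
    then obtain m where m: "m > 0" "\<And>v. v \<in> W \<Longrightarrow> m * (norm (F v))\<^sup>2 \<le> \<phi> (F v)" by blast
    have "m / K'\<^sup>2 * (norm v)\<^sup>2 \<le> \<phi> (F v)" if "v \<in> W" for v
    proof -
      have "(norm v)\<^sup>2 \<le> (norm (F v) * K')\<^sup>2" using K'(2)[of "F v"] by (simp add: G(2) power_mono)
      then have "m / K'\<^sup>2 * (norm v)\<^sup>2 \<le> m * (norm (F v))\<^sup>2"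
        using m(1) K'(1) by (simp add: field_simps power_mult_distrib)
      with m(2)[OF that] show ?thesis by simp
    qed
    then show "\<exists>m>0. \<forall>v\<in>W. m * (norm v)\<^sup>2 \<le> \<phi> (F v)"
      using m(1) K'(1) by (intro exI[of _ "m / K'\<^sup>2"]) simp
  next
    assume "\<exists>m>0. \<forall>v\<in>W. m * (norm v)\<^sup>2 \<le> \<phi> (F v)"
    then obtain m where m: "m > 0" "\<And>v. v \<in> W \<Longrightarrow> m * (norm v)\<^sup>2 \<le> \<phi> (F v)" by blast
    have "m / K\<^sup>2 * (norm (F v))\<^sup>2 \<le> \<phi> (F v)" if "v \<in> W" for v
    proof -
      have "(norm (F v))\<^sup>2 \<le> (norm v * K)\<^sup>2" using K(2)[of v] by (simp add: power_mono)
      then have "m / K\<^sup>2 * (norm (F v))\<^sup>2 \<le> m * (norm v)\<^sup>2"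
        using m(1) K(1) by (simp add: field_simps power_mult_distrib)
      with m(2)[OF that] show ?thesis by simp
    qed
    then show "\<exists>m>0. \<forall>u\<in>F ` W. m * (norm u)\<^sup>2 \<le> \<phi> u"
      using m(1) K(1) by (intro exI[of _ "m / K\<^sup>2"]) simp
  qed
qed

section \<open>Recovering periodic inputs\<close>

lemma ell2_norm_scale: "ell2_norm J (\<lambda>j. c * a j) = cmod c * ell2_norm J a"
  by (simp add: ell2_norm_def norm_mult power_mult_distrib infsum_cmult_right' real_sqrt_mult)

lemma sample_matrix_analysis: "sample_matrix J g x n = analysis J g (x n)"
  by (simp add: sample_matrix_def analysis_def)

lemma ell2_norm_le_B_norm: "D \<in> B_ell2_ellinf J \<Longrightarrow> ell2_norm J (D n) \<le> B_norm J D"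
  unfolding B_norm_def B_ell2_ellinf_def by (auto intro: cSUP_upper)

lemma power_norm_le_sum: "power_norm N h \<le> (\<Sum>i<N. norm (h i))"
  using L2_set_le_sum[of "{..<N}" "\<lambda>i. norm (h i)"] by (simp add: power_norm_def L2_set_def)

lemma recovery_imp_lower_bound:
  fixes A :: "'a::complex_hilbert \<Rightarrow> 'a"
  assumes A: "bounded_clinear A" "onorm A < 1" and N: "N \<ge> 1" and W: "csubspace W"
    and g: "bessel_sequence J g" and R: "bounded_operator_M J N W R"
    and rec: "\<And>w x. (\<forall>n. w n \<in> W) \<Longrightarrow> (\<forall>n. w (n + N) = w n) \<Longrightarrow>
      (\<forall>n. x (Suc n) = A (x n) + w n) \<Longrightarrow> R (sample_matrix J g x) = first_tuple N w"
  shows "\<exists>m>0. \<forall>v\<in>W. m * (norm v)\<^sup>2 \<le> (ell2_norm J (analysis J g (resolvent_root A N s v)))\<^sup>2"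
proof -
  let ?z = "unit_root N s"
  obtain K where K: "\<And>D. D \<in> M_space J N \<Longrightarrow> power_norm N (R D) \<le> K * B_norm J D"
    using R unfolding bounded_operator_M_def by blast
  \<comment> \<open>The input tuple has squared norm \<open>N * (norm v)\<^sup>2\<close>, and
    boundedness of \<open>R\<close> compares it with \<open>K\<^sup>2\<close> times the squared norm
    of a single row. Using \<open>K\<^sup>2 + 1\<close> guards against \<open>K = 0\<close>.\<close>
  have "N / (K\<^sup>2 + 1) * (norm v)\<^sup>2 \<le> (ell2_norm J (analysis J g (resolvent_root A N s v)))\<^sup>2"
    if v: "v \<in> W" for v
  proof -
    let ?u = "resolvent_root A N s v"
    let ?b = "ell2_norm J (analysis J g ?u)"
    define x where "x n = ?z ^ n *\<^sub>C ?u" for n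
    define w where "w n = ?z ^ n *\<^sub>C v" for n
    have "?z *\<^sub>C ?u = A ?u + v"
      using resolvent_root_right[OF A, of N s v] by (simp add: algebra_simps)
    then have "x (Suc n) = ?z ^ n *\<^sub>C (A ?u + v)" for n
      by (simp add: x_def scaleC_scaleC mult.commute flip: \<open>?z *\<^sub>C ?u = A ?u + v\<close>)
    then have "x (Suc n) = A (x n) + w n" for n
      using A(1) by (simp add: x_def w_def bounded_clinear_def scaleC_add_right)
    moreover have "w n \<in> W" "w (n + N) = w n" for n
      using v W unit_root_power_periodic[OF N, of s 1 n]
      by (simp_all add: w_def complex_vector.subspace_scale add.commute)
    ultimately have Rx: "R (sample_matrix J g x) = first_tuple N w"
      by (intro rec) auto
    have norm_row: "ell2_norm J (sample_matrix J g x n) = ?b" for n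
      by (simp add: sample_matrix_analysis x_def analysis_scale ell2_norm_scale norm_power)
    have "sample_matrix J g x \<in> M_space J N"
      unfolding M_space_def B_ell2_ellinf_def
    proof (intro CollectI conjI allI impI)
      show "sample_matrix J g x n \<in> ell2 J" for n
        by (simp add: sample_matrix_analysis analysis_ell2[OF g])
      \<comment> \<open>The rows are themselves \<open>N\<close>-periodic, so row \<open>r\<close>
        is its own limit.\<close>
      then show "\<exists>t\<in>ell2 J. (\<lambda>k. ell2_norm J (\<lambda>j. sample_matrix J g x (N * k + r) j - t j)) \<longlonglongrightarrow> 0"
        for r
        by (intro bexI[of _ "sample_matrix J g x r"])
          (simp_all add: sample_matrix_analysis x_def unit_root_power_periodic[OF N] ell2_norm_def)
    qed (simp add: norm_row)
    from K[OF this] have "power_norm N (first_tuple N w) \<le> K * ?b"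
      by (simp add: Rx B_norm_def norm_row)
    moreover have "power_norm N (first_tuple N w) = sqrt (N * (norm v)\<^sup>2)"
      by (simp add: power_norm_def first_tuple_def w_def norm_scaleC norm_power)
    ultimately have "(sqrt (N * (norm v)\<^sup>2))\<^sup>2 \<le> (K * ?b)\<^sup>2"
      by (intro power_mono) auto
    then have "N * (norm v)\<^sup>2 \<le> K\<^sup>2 * ?b\<^sup>2" by (simp add: power_mult_distrib)
    also have "\<dots> \<le> (K\<^sup>2 + 1) * ?b\<^sup>2" by (intro mult_right_mono) auto
    finally show ?thesis by (simp add: divide_le_eq mult.commute add_nonneg_pos)
  qed
  moreover have "0 < N / (K\<^sup>2 + 1)" using N by (simp add: add_nonneg_pos)
  ultimately show ?thesis by blast
qed

text \<open>
  Each row subsequence is mapped by the left inverse \<open>L s\<close> into \<open>W\<close> before passing to the limit,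
  so only limits in the Hilbert space are needed.
\<close>

lemma lower_bound_imp_recovery:
  fixes A :: "'a::complex_hilbert \<Rightarrow> 'a"
  assumes A: "bounded_clinear A" "onorm A < 1" and N: "N \<ge> 1" and W: "csubspace W" "closed W"
    and g: "bessel_sequence J g"
    and lower: "\<And>s. s < N \<Longrightarrow> \<exists>m>0. \<forall>v\<in>W.
      m * (norm v)\<^sup>2 \<le> (ell2_norm J (analysis J g (resolvent_root A N s v)))\<^sup>2"
  obtains R where "bounded_operator_M J N W R"
    and "\<And>w x. (\<forall>n. w n \<in> W) \<Longrightarrow> (\<forall>n. w (n + N) = w n) \<Longrightarrow>
      (\<forall>n. x (Suc n) = A (x n) + w n) \<Longrightarrow> R (sample_matrix J g x) = first_tuple N w"
proof -
  let ?T = "resolvent_root A N"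
  \<comment> \<open>Bundled into one predicate so that a single choice over \<open>s\<close>
    produces the families \<open>L\<close> and \<open>K\<close>.\<close>
  define left_inverse where "left_inverse s L K \<longleftrightarrow> (\<forall>a\<in>ell2 J. L a \<in> W) \<and>
    (\<forall>a\<in>ell2 J. \<forall>b\<in>ell2 J. L (\<lambda>j. a j + b j) = L a + L b) \<and>
    (\<forall>a\<in>ell2 J. \<forall>c. L (\<lambda>j. c * a j) = c *\<^sub>C L a) \<and>
    0 \<le> K \<and> (\<forall>a\<in>ell2 J. norm (L a) \<le> K * ell2_norm J a) \<and>
    (\<forall>v\<in>W. L (analysis J g (?T s v)) = v)" for s L and K :: real
  have "\<exists>L K. left_inverse s L K" if s: "s < N" for s
  proof -
    \<comment> \<open>The analysis operator of this family is that of \<open>g\<close> composed with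
      \<open>?T s\<close>, so its left inverse on \<open>W\<close> is the one sought.\<close>
    let ?f = "\<lambda>j. cadjoint (?T s) (g j)"
    note T = bounded_clinear_resolvent_root[OF A, of N s]
    obtain m where m: "m > 0" "\<And>v. v \<in> W \<Longrightarrow> m * (norm v)\<^sup>2 \<le> (ell2_norm J (analysis J ?f v))\<^sup>2"
      using lower[OF s] by (auto simp: analysis_cadjoint[OF T])
    show ?thesis
    proof (rule analysis_left_inverse[OF bessel_sequence_cadjoint[OF T g] W m, unfolded analysis_cadjoint[OF T]])
      fix L K
      assume "\<And>a. a \<in> ell2 J \<Longrightarrow> L a \<in> W"
        "\<And>a b. a \<in> ell2 J \<Longrightarrow> b \<in> ell2 J \<Longrightarrow> L (\<lambda>j. a j + b j) = L a + L b"
        "\<And>a c. a \<in> ell2 J \<Longrightarrow> L (\<lambda>j. c * a j) = c *\<^sub>C L a"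
        "0 \<le> K" "\<And>a. a \<in> ell2 J \<Longrightarrow> norm (L a) \<le> K * ell2_norm J a"
        "\<And>v. v \<in> W \<Longrightarrow> L (analysis J g (?T s v)) = v"
      then show ?thesis
        unfolding left_inverse_def by (intro exI[of _ L] exI[of _ K] conjI ballI allI)
    qed
  qed
  then obtain L K where "\<And>s. s < N \<Longrightarrow> left_inverse s (L s) (K s)"
    by metis
  then have L_in: "\<And>s a. s < N \<Longrightarrow> a \<in> ell2 J \<Longrightarrow> L s a \<in> W"
    and L_add: "\<And>s a b. s < N \<Longrightarrow> a \<in> ell2 J \<Longrightarrow> b \<in> ell2 J \<Longrightarrow> L s (\<lambda>j. a j + b j) = L s a + L s b"
    and L_scale: "\<And>s a c. s < N \<Longrightarrow> a \<in> ell2 J \<Longrightarrow> L s (\<lambda>j. c * a j) = c *\<^sub>C L s a"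
    and K: "\<And>s. s < N \<Longrightarrow> 0 \<le> K s"
    and L_le: "\<And>s a. s < N \<Longrightarrow> a \<in> ell2 J \<Longrightarrow> norm (L s a) \<le> K s * ell2_norm J a"
    and L_inv: "\<And>s v. s < N \<Longrightarrow> v \<in> W \<Longrightarrow> L s (analysis J g (?T s v)) = v"
    unfolding left_inverse_def by blast+
  have L_diff: "L s (\<lambda>j. a j - b j) = L s a - L s b" if "s < N" "a \<in> ell2 J" "b \<in> ell2 J" for s a b
    using L_add[OF that(1) ell2_diff[OF that(2,3)] that(3)] by (simp add: algebra_simps)

  define ell where "ell D s l = lim (\<lambda>k. L s (D (N * k + l)))" for D s l
  \<comment> \<open>From the outputs of \<open>L s\<close> only the coefficient of frequency
    \<open>s\<close> is kept: \<open>L s\<close> has no control over the other components of the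
    steady state. The inverse transform then reassembles the input from these coefficients.\<close>
  define R where "R D = first_tuple N (idft N (\<lambda>s. dft N (ell D s) s))" for D
  have row: "D n \<in> ell2 J" "ell2_norm J (D n) \<le> B_norm J D" if "D \<in> M_space J N" for D n
    using that ell2_norm_le_B_norm[of D J n] by (auto simp: M_space_def B_ell2_ellinf_def)
  have ell: "(\<lambda>k. L s (D (N * k + l))) \<longlonglongrightarrow> ell D s l"
    if D: "D \<in> M_space J N" and "s < N" "l < N" for D s l
  proof -
    obtain t where t: "t \<in> ell2 J" "(\<lambda>k. ell2_norm J (\<lambda>j. D (N * k + l) j - t j)) \<longlonglongrightarrow> 0"
      using D \<open>l < N\<close> unfolding M_space_def by blast
    have "(\<lambda>k. K s * ell2_norm J (\<lambda>j. D (N * k + l) j - t j)) \<longlonglongrightarrow> 0"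
      using t(2) by (rule tendsto_mult_right_zero)
    then have "(\<lambda>k. L s (D (N * k + l)) - L s t) \<longlonglongrightarrow> 0"
    proof (rule Lim_null_comparison[rotated], intro always_eventually allI)
      fix k
      show "norm (L s (D (N * k + l)) - L s t) \<le> K s * ell2_norm J (\<lambda>j. D (N * k + l) j - t j)"
        using L_le[OF \<open>s < N\<close> ell2_diff[OF row(1)[OF D] t(1)], of "N * k + l"]
        by (simp only: L_diff[OF \<open>s < N\<close> row(1)[OF D] t(1)])
    qed
    then have "(\<lambda>k. L s (D (N * k + l))) \<longlonglongrightarrow> L s t" by (rule Lim_null[THEN iffD2])
    then show ?thesis unfolding ell_def by (simp add: limI)
  qed
  have ell_in: "ell D s l \<in> W" if "D \<in> M_space J N" "s < N" "l < N" for D s l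
    using closed_sequentially[OF W(2) _ ell[OF that]] L_in[OF that(2) row(1)[OF that(1)]] by blast
  have ell_le: "norm (ell D s l) \<le> K s * B_norm J D" if "D \<in> M_space J N" "s < N" "l < N" for D s l
  proof (rule Lim_norm_ubound[OF _ ell[OF that]])
    have "norm (L s (D n)) \<le> K s * B_norm J D" for n
      using L_le[OF that(2) row(1)[OF that(1)], of n]
        mult_left_mono[OF row(2)[OF that(1)] K[OF that(2)], of n] by linarith
    then show "\<forall>\<^sub>F k in sequentially. norm (L s (D (N * k + l))) \<le> K s * B_norm J D"
      by simp
  qed simp
  have "bounded_operator_M J N W R"
    unfolding bounded_operator_M_def
  proof (intro conjI ballI allI)
    show "R D \<in> power_space W N" if "D \<in> M_space J N" for D
      using that by (auto simp: R_def first_tuple_def power_space_def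
          intro!: idft_in dft_in W(1) ell_in)
  next
    fix D E assume D: "D \<in> M_space J N" and E: "E \<in> M_space J N"
    have "ell (\<lambda>n j. D n j + E n j) s l = ell D s l + ell E s l" if "s < N" "l < N" for s l
      unfolding ell_def[of "\<lambda>n j. D n j + E n j"]
      using tendsto_add[OF ell[OF D that] ell[OF E that]]
      by (intro limI) (simp add: L_add[OF that(1) row(1)[OF D] row(1)[OF E]])
    then have "idft N (\<lambda>s. dft N (ell (\<lambda>n j. D n j + E n j) s) s) i =
        idft N (\<lambda>s. dft N (\<lambda>l. ell D s l + ell E s l) s) i" for i
      by (intro idft_cong dft_cong) simp
    then show "R (\<lambda>n j. D n j + E n j) = (\<lambda>i. R D i + R E i)"
      by (auto simp: R_def first_tuple_def dft_add idft_add)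
  next
    fix c D assume D: "D \<in> M_space J N"
    have "ell (\<lambda>n j. c * D n j) s l = c *\<^sub>C ell D s l" if "s < N" "l < N" for s l
      unfolding ell_def[of "\<lambda>n j. c * D n j"]
      using bounded_linear.tendsto[OF bounded_linear_scaleC ell[OF D that], of c]
      by (intro limI) (simp add: L_scale[OF that(1) row(1)[OF D]])
    then have "idft N (\<lambda>s. dft N (ell (\<lambda>n j. c * D n j) s) s) i =
        idft N (\<lambda>s. dft N (\<lambda>l. c *\<^sub>C ell D s l) s) i" for i
      by (intro idft_cong dft_cong) simp
    then show "R (\<lambda>n j. c * D n j) = (\<lambda>i. c *\<^sub>C R D i)"
      by (auto simp: R_def first_tuple_def dft_scale idft_scale)
  next
    have "power_norm N (R D) \<le> (\<Sum>i<N. \<Sum>s<N. \<Sum>l<N. K s) * B_norm J D"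
      if D: "D \<in> M_space J N" for D
    proof -
      have dft: "norm (dft N (ell D s) s) \<le> (\<Sum>l<N. K s * B_norm J D)" if "s < N" for s
        by (rule order_trans[OF norm_dft_le]) (intro sum_mono ell_le D that, simp)
      have "power_norm N (R D) \<le> (\<Sum>i<N. norm (idft N (\<lambda>s. dft N (ell D s) s) i))"
        using power_norm_le_sum[of N "R D"] by (simp add: R_def first_tuple_def)
      also have "\<dots> \<le> (\<Sum>i<N. \<Sum>s<N. \<Sum>l<N. K s * B_norm J D)"
        using dft by (intro sum_mono order_trans[OF norm_idft_le]) auto
      finally show ?thesis by (simp only: sum_distrib_right)
    qed
    then show "\<exists>K. \<forall>D\<in>M_space J N. power_norm N (R D) \<le> K * B_norm J D" by blast
  qed
  moreover have "R (sample_matrix J g x) = first_tuple N w"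
    if w: "\<forall>n. w n \<in> W" "\<forall>n. w (n + N) = w n" and x: "\<forall>n. x (Suc n) = A (x n) + w n" for w x
  proof -
    have "dft N (ell (sample_matrix J g x) s) s = dft N w s" if s: "s < N" for s
    proof -
      let ?z = "idft N (\<lambda>s. ?T s (dft N w s))"
      \<comment> \<open>Although \<open>F\<close> inverts \<open>?T s\<close> only on
        \<open>W\<close>, it is bounded and complex linear on the whole space; so it commutes both
        with the limit to the steady state and with the Fourier transform.\<close>
      define F where "F v = L s (analysis J g v)" for v
      obtain M where M: "0 \<le> M" "\<And>v. ell2_norm J (analysis J g v) \<le> M * norm v"
        using analysis_bounded[OF g] by blast
      have F_scale: "F (c *\<^sub>C v) = c *\<^sub>C F v" for c v
        by (simp add: F_def analysis_scale L_scale[OF s analysis_ell2[OF g]])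
      have "bounded_linear F"
      proof (rule bounded_linear_intro[where K = "K s * M"])
        show "F (u + v) = F u + F v" for u v
          by (simp add: F_def analysis_add L_add[OF s analysis_ell2[OF g] analysis_ell2[OF g]])
        show "F (r *\<^sub>R v) = r *\<^sub>R F v" for r v
          by (simp add: scaleR_scaleC F_scale)
        show "norm (F v) \<le> norm v * (K s * M)" for v
          using L_le[OF s analysis_ell2[OF g], of v] mult_left_mono[OF M(2)[of v] K[OF s]]
          by (simp add: F_def mult_ac)
      qed
      then have F: "bounded_clinear F" by (simp add: bounded_clinear_def F_scale)
      have "ell (sample_matrix J g x) s l = F (?z l)" for l
        unfolding ell_def sample_matrix_analysis
        using bounded_linear.tendsto[OF \<open>bounded_linear F\<close>
            tendsto_steady_state[OF A N, of w x l]] w(2) x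
        by (intro limI) (simp add: F_def)
      then have "dft N (ell (sample_matrix J g x) s) s = F (dft N ?z s)"
        unfolding clinear_dft[OF F] by (intro dft_cong)
      \<comment> \<open>The transform isolates the frequency \<open>s\<close> component of the
        steady state, on which \<open>L s\<close> is a true left inverse because the Fourier
        coefficient of \<open>w\<close> lies in \<open>W\<close>.\<close>
      also have "\<dots> = F (?T s (dft N w s))" by (simp add: dft_idft[OF s])
      also have "\<dots> = dft N w s"
        unfolding F_def using w(1) by (intro L_inv s dft_in W(1)) auto
      finally show ?thesis .
    qed
    then have "idft N (\<lambda>s. dft N (ell (sample_matrix J g x) s) s) i = idft N (dft N w) i" for i
      by (rule idft_cong)
    then show ?thesis
      by (auto simp: R_def first_tuple_def idft_dft)
  qed
  ultimately show ?thesis by (rule that)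
qed

theorem theorem2p2:
  fixes A :: "'h::complex_hilbert \<Rightarrow> 'h"
    and N :: nat
    and W :: "'h set"
    and J :: "'j set"
    and g :: "'j \<Rightarrow> 'h"
  assumes "separable_space (euclidean :: 'h topology)"
    and "bounded_clinear A"
    and "onorm A < 1"
    and "N \<ge> 1"
    and "csubspace W"
    and "closed W"
    and "countable J"
    and "bessel_sequence J g"
  defines "T \<equiv> resolvent_root A N"
  shows "((\<exists>R. bounded_operator_M J N W R \<and>
            (\<forall>w x. (\<forall>n. w n \<in> W) \<and> (\<forall>n. w (n + N) = w n) \<and>
                   (\<forall>n. x (Suc n) = A (x n) + w n) \<longrightarrow>
                   R (sample_matrix J g x) = first_tuple N w))
          \<longleftrightarrow> (\<forall>s<N. frame_of J (\<lambda>j. orth_proj W (cadjoint (T s) (g j))) W))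
       \<and> ((\<forall>s<N. frame_of J (\<lambda>j. orth_proj W (cadjoint (T s) (g j))) W)
          \<longleftrightarrow> (\<forall>s<N. frame_of J (\<lambda>j. orth_proj (T s ` W) (g j)) (T s ` W)))"
proof -
  note A = assms(2,3) and W = assms(5,6) and g = assms(8)
  let ?bound = "\<lambda>s. \<exists>m>0. \<forall>v\<in>W. m * (norm v)\<^sup>2 \<le> (ell2_norm J (analysis J g (T s v)))\<^sup>2"
  have T: "bounded_clinear (T s)" for s
    unfolding T_def by (rule bounded_clinear_resolvent_root[OF A])
  have frame2: "frame_of J (\<lambda>j. orth_proj W (cadjoint (T s) (g j))) W \<longleftrightarrow> ?bound s" for s
    by (simp only: frame_of_orth_proj_iff[OF bessel_sequence_cadjoint[OF T g] W] analysis_cadjoint[OF T])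
  have frame3: "frame_of J (\<lambda>j. orth_proj (T s ` W) (g j)) (T s ` W) \<longleftrightarrow> ?bound s" for s
  proof -
    define B where "B x = unit_root N s *\<^sub>C x - A x" for x
    have B: "bounded_linear B" and BT: "B (T s v) = v" and TB: "T s (B v) = v" for v
      using bounded_clinear_shift[OF A, of N s] resolvent_root_right[OF A, of N s v]
        resolvent_root_left[OF A, of N s v]
      by (simp_all add: B_def[abs_def] T_def bounded_clinear_def)
    have lin: "bounded_linear (T s)" "\<And>c v. T s (c *\<^sub>C v) = c *\<^sub>C T s v"
      using T by (auto simp: bounded_clinear_def)
    \<comment> \<open>As a preimage of \<open>W\<close> under a continuous map the image is closed,
      so that it admits an orthogonal projection.\<close>
    have "T s ` W = B -` W"
    proof (intro equalityI subsetI)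
      show "u \<in> T s ` W" if "u \<in> B -` W" for u
        using that image_eqI[of u "T s" "B u" W] by (simp add: TB)
    qed (auto simp: BT)
    then have closed: "closed (T s ` W)"
      using closed_vimage[OF W(2) linear_continuous_on[OF B, of UNIV]] by simp
    have sub: "csubspace (T s ` W)"
      using W(1) unfolding complex_vector.subspace_def
      by (auto simp flip: lin(2) linear_add[OF bounded_linear.linear[OF lin(1)]]
          intro!: image_eqI[of 0 _ 0] simp: linear_0[OF bounded_linear.linear[OF lin(1)]])
    show ?thesis
      unfolding frame_of_orth_proj_iff[OF g sub closed]
      by (rule lower_bound_image_iff[OF lin(1) B BT])
  qed
  have "(\<exists>R. bounded_operator_M J N W R \<and>
      (\<forall>w x. (\<forall>n. w n \<in> W) \<and> (\<forall>n. w (n + N) = w n) \<and> (\<forall>n. x (Suc n) = A (x n) + w n) \<longrightarrow>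
        R (sample_matrix J g x) = first_tuple N w)) \<longleftrightarrow> (\<forall>s<N. ?bound s)" (is "?recovery \<longleftrightarrow> _")
  proof
    assume ?recovery
    then obtain R where R: "bounded_operator_M J N W R"
      "\<And>w x. (\<forall>n. w n \<in> W) \<Longrightarrow> (\<forall>n. w (n + N) = w n) \<Longrightarrow>
        (\<forall>n. x (Suc n) = A (x n) + w n) \<Longrightarrow> R (sample_matrix J g x) = first_tuple N w"
      by blast
    show "\<forall>s<N. ?bound s"
      unfolding T_def using recovery_imp_lower_bound[OF A assms(4) W(1) g R] by blast
  next
    assume bound: "\<forall>s<N. ?bound s"
    show ?recovery
      by (rule lower_bound_imp_recovery[OF A assms(4) W g]) (use bound in \<open>auto simp: T_def\<close>)
  qed
  then show ?thesis by (simp only: frame2 frame3)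
qed

end
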